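(* Let $k$ be a field of characteristic $2$ and let $V_4$ be the Klein four group. Every even dimensional (finite-dimensional) indecomposable representation $M$ of $V_4$ over $k$ is self-dual, i.e. $M \cong M^*$ as $kV_4$-modules.
   Context: A representation of $V_4$ over $k$ is a finite-dimensional $kV_4$-module. For such $M$, the dual representation is $M^* = \mathrm{Hom}_k(M,k)$, with a group element $g$ acting on a linear functional $\phi$ by $(g\cdot\phi)(x) = \phi(g^{-1}x)$. A representation is self-dual if it is isomorphic to its dual. *)

theory Defs
  imports
    "HOL-Algebra.Group_Action"
    "HOL-Algebra.Elementary_Groups"
    "HOL-Computational_Algebra.Computational_Algebra"
    "HOL-Library.Function_Algebras"
begin

definition klein_four_group :: "('g, 'h) monoid_scheme \<Rightarrow> bool" where
  "klein_four_group G \<longleftrightarrow>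
     group G \<and> G \<cong> integer_mod_group 2 \<times>\<times> integer_mod_group 2"

text \<open>
  A finite-dimensional \<open>kG\<close>-module: a finite-dimensional \<open>k\<close>-vector space, whose underlying set
  is the whole type \<open>'v\<close>, with a left action of \<open>G\<close> by \<open>k\<close>-linear maps.
\<close>

locale group_representation =
  group_action G "UNIV :: 'v set" \<rho> + vector_space scale
  for G :: "('g, 'h) monoid_scheme" (structure)
    and \<rho> :: "'g \<Rightarrow> 'v \<Rightarrow> 'v::ab_group_add"
    and scale :: "'k::field \<Rightarrow> 'v \<Rightarrow> 'v" +
  assumes linear_action: "g \<in> carrier G \<Longrightarrow> Vector_Spaces.linear scale scale (\<rho> g)"
    and finite_dimensional: "\<exists>B. finite B \<and> span B = UNIV"
begin

definition subrepresentation :: "'v set \<Rightarrow> bool" where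
  "subrepresentation W \<longleftrightarrow> subspace W \<and> (\<forall>g\<in>carrier G. \<rho> g ` W \<subseteq> W)"

text \<open>The zero module is not indecomposable.\<close>

definition indecomposable :: bool where
  "indecomposable \<longleftrightarrow> (UNIV :: 'v set) \<noteq> {0} \<and>
     (\<forall>U W. subrepresentation U \<and> subrepresentation W \<and>
        U \<inter> W = {0} \<and> {u + w |u w. u \<in> U \<and> w \<in> W} = UNIV \<longrightarrow> U = {0} \<or> W = {0})"

text \<open>
  The dual is a set of functions \<open>'v \<Rightarrow> 'k\<close>; its addition is the pointwise one.
\<close>

definition dual_space :: "('v \<Rightarrow> 'k) set" where
  "dual_space = {\<phi>. Vector_Spaces.linear scale (*) \<phi>}"

definition dual_scale :: "'k \<Rightarrow> ('v \<Rightarrow> 'k) \<Rightarrow> 'v \<Rightarrow> 'k" where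
  "dual_scale c \<phi> = (\<lambda>x. c * \<phi> x)"

definition dual_action :: "'g \<Rightarrow> ('v \<Rightarrow> 'k) \<Rightarrow> 'v \<Rightarrow> 'k" where
  "dual_action g \<phi> = (\<lambda>x. \<phi> (\<rho> (inv g) x))"

definition self_dual :: bool where
  "self_dual \<longleftrightarrow>
     (\<exists>f. Vector_Spaces.linear scale dual_scale f \<and> bij_betw f UNIV dual_space \<and>
        (\<forall>g\<in>carrier G. \<forall>x. f (\<rho> g x) = dual_action g (f x)))"

lemma vector_space_dual_scale: "vector_space dual_scale"
  by unfold_locales (auto simp: dual_scale_def fun_eq_iff algebra_simps)

lemma subspace_dual_space: "module.subspace dual_scale dual_space"
proof -
  interpret D: vector_space dual_scale by (rule vector_space_dual_scale)
  interpret K: vector_space "(*) :: 'k \<Rightarrow> 'k \<Rightarrow> 'k"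
    by unfold_locales (auto simp: algebra_simps)
  interpret P: vector_space_pair scale "(*) :: 'k \<Rightarrow> 'k \<Rightarrow> 'k" ..
  show ?thesis
    unfolding D.subspace_def dual_space_def dual_scale_def plus_fun_def zero_fun_def
    by (auto intro: P.linear_compose_add P.linear_compose_scale_right P.linear_zero)
qed

lemma linear_dual_action: "Vector_Spaces.linear dual_scale dual_scale (dual_action g)"
proof -
  interpret D: vector_space dual_scale by (rule vector_space_dual_scale)
  show ?thesis
    by unfold_locales (auto simp: dual_scale_def dual_action_def fun_eq_iff)
qed

lemma dual_action_closed:
  assumes "g \<in> carrier G" "\<phi> \<in> dual_space"
  shows "dual_action g \<phi> \<in> dual_space"
proof -
  interpret group_hom G "BijGroup (UNIV :: 'v set)" \<rho> by (rule group_hom)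
  have "Vector_Spaces.linear scale (*) (\<phi> \<circ> \<rho> (inv g))"
    using assms linear_action[of "inv g"]
    by (intro Vector_Spaces.linear_compose) (auto simp: dual_space_def)
  then show ?thesis
    by (simp add: dual_space_def dual_action_def o_def)
qed

lemma dual_action_one: "dual_action \<one> \<phi> = \<phi>"
proof -
  interpret G: group G using group_hom by (rule group_hom.axioms)
  show ?thesis
    by (simp add: dual_action_def flip: id_eq_one)
qed

lemma dual_action_mult:
  assumes "g \<in> carrier G" "h \<in> carrier G"
  shows "dual_action (g \<otimes> h) \<phi> = dual_action g (dual_action h \<phi>)"
proof -
  interpret G: group G using group_hom by (rule group_hom.axioms)
  show ?thesis
    using assms
    by (simp add: dual_action_def G.inv_mult_group composition_rule)
qed

end

end

theory Submission
  imports Defs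
begin

text \<open>
  Put \<open>X = a - 1\<close> and \<open>Y = b - 1\<close> for generators \<open>a\<close>, \<open>b\<close> of the group: in characteristic 2 these are
  commuting operators of square zero. A symmetric nondegenerate form on the space turns the dual module
  into the same space with the adjoint operators.

  If \<open>XY\<close> is nonzero, or if \<open>ker X = im X\<close>, the module is cyclic over a commutative algebra of operators
  containing \<open>X\<close> and \<open>Y\<close>, and has a functional killing no nonzero operator of that algebra; this gives
  \<open>M \<cong> M\<^sup>*\<close>. In the second case the algebra is \<open>k[T, X]\<close> with \<open>Y = XT\<close>, and \<open>T\<close> is primary by Fitting's lemma.

  Otherwise the module is a Kronecker module. If \<open>ker Y\<close> is not contained in \<open>ker X\<close>, consider chains
  \<open>Y x\<^sub>0 = 0\<close>, \<open>Y x\<^sub>i\<^sub>+\<^sub>1 = X x\<^sub>i\<close>. Either some chain of minimal length cannot be continued, and then it generates a direct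
  summand on which \<open>ker X = im X\<close>; or some chain ends with \<open>X x\<^sub>e = 0\<close>, and a shortest nontrivial one generates a direct
  summand of dimension \<open>2e + 1\<close>. In even dimension this argument, applied to the module and to its dual, leaves
  only \<open>ker X = im X\<close> or \<open>ker Y = im Y\<close>.
\<close>

section \<open>Finite linear systems over a field\<close>

text \<open>Equation \<open>k - j\<close> has no unknown of index below \<open>j\<close>, and its
  coefficient at \<open>a j\<close> lies on the antidiagonal. So the unknowns vanish one after
  another, from \<open>a k\<close> down to \<open>a 0\<close>.\<close>

lemma antitriangular_system_zero:
  fixes h :: "nat \<Rightarrow> nat \<Rightarrow> 'a::field" and a :: "nat \<Rightarrow> 'a" and k :: nat
  assumes low: "\<And>i j. i + j < k \<Longrightarrow> h i j = 0" and diag: "\<And>i j. i + j = k \<Longrightarrow> h i j \<noteq> 0"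
    and eq: "\<And>i. i \<le> k \<Longrightarrow> (\<Sum>j\<le>k. a j * h i j) = 0"
  shows "j \<le> k \<Longrightarrow> a j = 0"
proof (induction "k - j" arbitrary: j rule: less_induct)
  case less
  have "(\<Sum>l\<in>{..k} - {j}. a l * h (k - j) l) = 0"
  proof (rule sum.neutral, rule ballI)
    fix l assume "l \<in> {..k} - {j}"
    then have l: "l \<le> k" "l \<noteq> j" by auto
    show "a l * h (k - j) l = 0"
    proof (cases "l < j")
      case True
      then have "h (k - j) l = 0" using less.prems by (intro low) linarith
      then show ?thesis by simp
    next
      case False
      then have "a l = 0" using l less.prems by (intro less.hyps) linarith+
      then show ?thesis by simp
    qed
  qed
  then have "a j * h (k - j) j = 0"
    using eq[of "k - j"] sum.remove[of "{..k}" j "\<lambda>l. a l * h (k - j) l"] less.prems by simp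
  then show ?case using diag[of "k - j" j] less.prems by simp
qed

lemma sum_mult_delta:
  fixes a :: "'b \<Rightarrow> 'a::semiring_0"
  assumes "finite I" "i \<in> I"
  shows "(\<Sum>j\<in>I. a j * (if i = j then c else 0)) = a i * c"
    and "(\<Sum>j\<in>I. a j * (if j = i then c else 0)) = a i * c"
proof -
  have "(\<Sum>j\<in>I. a j * (if i = j then c else 0)) = (\<Sum>j\<in>I. if i = j then a j * c else 0)"
    by (intro sum.cong) auto
  then show "(\<Sum>j\<in>I. a j * (if i = j then c else 0)) = a i * c" using assms by simp
  then show "(\<Sum>j\<in>I. a j * (if j = i then c else 0)) = a i * c" by (simp add: eq_commute)
qed

section \<open>Duality on a coordinate space\<close>

locale coordinate_space = finite_dimensional_vector_space scale Basis
  for scale :: "'k::field \<Rightarrow> 'v::ab_group_add \<Rightarrow> 'v" (infixr \<open>*s\<close> 75)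
    and Basis :: "'v set"

sublocale coordinate_space \<subseteq> endo: finite_dimensional_vector_space_pair scale Basis scale Basis ..

context coordinate_space
begin

abbreviation lin :: "('v \<Rightarrow> 'v) \<Rightarrow> bool" where
  "lin \<equiv> Vector_Spaces.linear scale scale"

lemma linI:
  assumes "\<And>x y. f (x + y) = f x + f y" "\<And>c x. f (c *s x) = c *s f x"
  shows "lin f"
  by unfold_locales (simp_all add: assms)

lemma lin_iff: "lin f \<longleftrightarrow> (\<forall>x y. f (x + y) = f x + f y) \<and> (\<forall>c x. f (c *s x) = c *s f x)"
  unfolding Vector_Spaces.linear_iff using vector_space_axioms by metis

lemmas lin_simps = endo.linear_add endo.linear_scale endo.linear_0 endo.linear_diff endo.linear_neg endo.linear_sum

lemma lin_id: "lin (\<lambda>x. x)" "lin id"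
  by (simp_all add: lin_iff)

lemma lin_comp: "lin f \<Longrightarrow> lin g \<Longrightarrow> lin (\<lambda>x. f (g x))"
  by (simp add: lin_iff)

lemma lin_funpow: "lin f \<Longrightarrow> lin (f ^^ n)"
  by (induction n) (auto simp: lin_iff)

section \<open>Dimensions and complements\<close>

text \<open>Rank-nullity on a subspace: a right inverse \<open>g\<close> of \<open>f\<close>,
  defined on the image of \<open>S\<close> with values in \<open>S\<close>, splits \<open>S\<close>
  into a copy of the image and the kernel.\<close>

lemma dim_image_kernel:
  assumes f: "lin f" and S: "subspace S"
  shows "dim (f ` S) + dim {x \<in> S. f x = 0} = dim S"
proof -
  let ?N = "{x \<in> S. f x = 0}"
  have fS: "subspace (f ` S)" using f S by (rule endo.linear_subspace_image)
  have sN: "subspace ?N"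
    using S f by (auto simp: subspace_def lin_iff endo.linear_0)
  obtain g where g: "g ` UNIV \<subseteq> S" "lin g" "\<forall>v\<in>f ` S. f (g v) = v"
    using endo.linear_exists_right_inverse_on[OF f S] by blast
  let ?G = "g ` f ` S"
  have sG: "subspace ?G" using g(2) fS by (rule endo.linear_subspace_image)
  have inj: "inj_on g (f ` S)" using g(3) by (metis inj_on_def)
  then have "dim ?G = dim (f ` S)"
    using fS by (intro endo.dim_image_eq[OF g(2)]) (metis span_eq_iff)
  moreover have "?G \<inter> ?N \<subseteq> {0}"
    using g(3) endo.linear_0[OF g(2)] by auto
  moreover have "{x + y |x y. x \<in> ?G \<and> y \<in> ?N} = S"
  proof
    show "{x + y |x y. x \<in> ?G \<and> y \<in> ?N} \<subseteq> S"
      using g(1) S by (auto intro!: subspace_add)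
    show "S \<subseteq> {x + y |x y. x \<in> ?G \<and> y \<in> ?N}"
    proof
      fix x assume x: "x \<in> S"
      have "x = g (f x) + (x - g (f x))" by simp
      moreover have "x - g (f x) \<in> ?N"
        using x g S f by (auto simp: endo.linear_diff intro!: subspace_diff)
      ultimately show "x \<in> {x + y |x y. x \<in> ?G \<and> y \<in> ?N}" using x by blast
    qed
  qed
  ultimately show ?thesis
    using dim_sums_Int[OF sG sN] by (metis (no_types, lifting) add.commute add_0 dim_eq_0)
qed

lemma dim_direct_sum:
  assumes "subspace S" "subspace T" "S \<inter> T \<subseteq> {0}"
  shows "dim {x + y |x y. x \<in> S \<and> y \<in> T} = dim S + dim T"
proof -
  have "dim (S \<inter> T) = 0" using assms(3) dim_eq_0 by blast
  then show ?thesis using dim_sums_Int[OF assms(1,2)] by linarith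
qed

lemma direct_sum_dim_le:
  assumes "subspace S" "subspace T" "S \<inter> T \<subseteq> {0}"
  shows "dim S + dim T \<le> dim UNIV"
  unfolding dim_direct_sum[OF assms, symmetric] by (intro dim_subset subset_UNIV)

lemma subspace_eq_UNIV: "subspace S \<Longrightarrow> dim UNIV \<le> dim S \<Longrightarrow> S = UNIV"
  by (rule subspace_dim_equal) simp_all

text \<open>The complement is the kernel of a linear projection \<open>g\<close> onto
  \<open>S\<close>, which fixes a basis of \<open>S\<close>.\<close>

lemma exists_complement:
  assumes "subspace S"
  obtains T where "subspace T" "S \<inter> T = {0}" "dim S + dim T = dim UNIV"
    "{x + y |x y. x \<in> S \<and> y \<in> T} = UNIV"
proof -
  obtain B where B: "independent B" "span B = S"
    using basis_subspace_exists[OF assms] by metis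
  define g where "g = endo.construct B id"
  have g: "lin g" "\<And>b. b \<in> B \<Longrightarrow> g b = b"
    unfolding g_def by (simp_all add: endo.linear_construct endo.construct_basis B)
  have gS: "g x \<in> S" for x
    using endo.construct_in_span[of B id x] B unfolding g_def by simp
  have gid: "g x = x" if "x \<in> S" for x
    using endo.linear_eq_on[OF g(1) lin_id(1), of x B] that g(2) B(2) by simp
  let ?T = "{x. g x = 0}"
  show ?thesis
  proof
    show "subspace ?T" using g(1) by (rule endo.linear_subspace_kernel)
    show "S \<inter> ?T = {0}" using gid endo.linear_0[OF g(1)] assms by (auto simp: subspace_0)
    have "g ` UNIV = S"
    proof
      show "g ` UNIV \<subseteq> S" using gS by blast
      show "S \<subseteq> g ` UNIV" using gid by (metis rangeI subsetI)
    qed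
    then show "dim S + dim ?T = dim UNIV"
      using dim_image_kernel[OF g(1) subspace_UNIV] by simp
    have "\<exists>a b. x = a + b \<and> a \<in> S \<and> b \<in> ?T" for x
    proof -
      have "x = g x + (x - g x)" by simp
      moreover have "x - g x \<in> ?T" using gid gS g(1) by (simp add: endo.linear_diff)
      ultimately show ?thesis using gS by blast
    qed
    then show "{x + y |x y. x \<in> S \<and> y \<in> ?T} = UNIV" by blast
  qed
qed

section \<open>The standard form and adjoint operators\<close>

text \<open>The symmetric bilinear form for which \<open>Basis\<close> is orthonormal. It identifies
  the space with its dual, so that a module and its dual live on the same type.\<close>

definition form :: "'v \<Rightarrow> 'v \<Rightarrow> 'k" where
  "form x y = (\<Sum>b\<in>Basis. representation Basis x b * representation Basis y b)"

lemma in_span_Basis [simp]: "x \<in> span Basis"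
  by (simp add: span_Basis)

lemma form_commute: "form x y = form y x"
  by (simp add: form_def mult.commute)

lemma form_add: "form (x + y) z = form x z + form y z" "form z (x + y) = form z x + form z y"
  by (simp_all add: form_def representation_add independent_Basis algebra_simps sum.distrib)

lemma form_scale: "form (c *s x) z = c * form x z" "form z (c *s x) = c * form z x"
  by (simp_all add: form_def representation_scale independent_Basis sum_distrib_left algebra_simps)

lemma form_zero [simp]: "form 0 x = 0" "form x 0 = 0"
  by (simp_all add: form_def representation_zero)

lemma form_diff: "form (x - y) z = form x z - form y z" "form z (x - y) = form z x - form z y"
  by (simp_all add: form_def representation_diff independent_Basis algebra_simps sum_subtractf)

lemma form_sum: "form (sum f A) z = (\<Sum>a\<in>A. form (f a) z)" "form z (sum f A) = (\<Sum>a\<in>A. form z (f a))"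
  by (induction A rule: infinite_finite_induct) (simp_all add: form_add)

lemmas form_simps = form_add form_scale form_diff form_sum

lemma form_Basis:
  assumes "b \<in> Basis"
  shows "form x b = representation Basis x b"
proof -
  have "form x b = (\<Sum>c\<in>Basis. if b = c then representation Basis x c else 0)"
    unfolding form_def using assms
    by (intro sum.cong) (simp_all add: representation_basis independent_Basis)
  then show ?thesis using assms finite_Basis by simp
qed

lemma Basis_expansion: "(\<Sum>b\<in>Basis. form x b *s b) = x"
  using sum_representation_eq[OF independent_Basis in_span_Basis finite_Basis order_refl, of x]
  by (simp add: form_Basis)

lemma form_nondegenerate: "(\<And>y. form x y = 0) \<Longrightarrow> x = 0"
  using Basis_expansion[of x] by simp

lemma form_eqI: "(\<And>z. form x z = form y z) \<Longrightarrow> x = y"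
  using form_nondegenerate[of "x - y"] by (simp add: form_diff)

definition adj :: "('v \<Rightarrow> 'v) \<Rightarrow> 'v \<Rightarrow> 'v" where
  "adj T y = (\<Sum>b\<in>Basis. form y (T b) *s b)"

text \<open>Every functional is represented by the vector whose coordinates are its values on
  \<open>Basis\<close>. This yields the adjoint identity, and later the surjectivity onto
  \<open>dual_space\<close>.\<close>

lemma functional_eq_form:
  assumes "\<And>x y. \<phi> (x + y) = \<phi> x + \<phi> y" "\<And>c x. \<phi> (c *s x) = c * \<phi> x"
  shows "\<phi> x = form (\<Sum>b\<in>Basis. \<phi> b *s b) x"
proof -
  have "\<phi> 0 = 0" using assms(2)[of 0 0] by simp
  then have sum: "\<phi> (sum f A) = (\<Sum>a\<in>A. \<phi> (f a))" for f :: "'v \<Rightarrow> 'v" and A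
    by (induction A rule: infinite_finite_induct) (simp_all add: assms)
  have "\<phi> x = \<phi> (\<Sum>b\<in>Basis. form x b *s b)" by (simp add: Basis_expansion)
  also have "\<dots> = form (\<Sum>b\<in>Basis. \<phi> b *s b) x"
    by (simp add: sum assms form_simps form_commute mult.commute)
  finally show ?thesis .
qed

lemma form_adj: "lin T \<Longrightarrow> form (adj T y) x = form y (T x)"
  unfolding adj_def
  by (rule functional_eq_form[of "\<lambda>x. form y (T x)", symmetric]) (simp_all add: lin_simps form_simps)

lemma lin_adj: "lin (adj T)"
  by (rule linI) (simp_all add: adj_def form_simps scale_left_distrib sum.distrib scale_sum_right)

lemma form_adj2: "lin T \<Longrightarrow> form x (adj T y) = form (T x) y"
  by (metis form_adj form_commute)

section \<open>Orthogonal subspaces\<close>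

text \<open>The annihilator of \<open>S\<close>, moved into the space itself. Isotropic vectors may
  exist, so \<open>perp S\<close> can meet \<open>S\<close> and need not be a complement of
  it.\<close>

definition perp :: "'v set \<Rightarrow> 'v set" where
  "perp S = {x. \<forall>y\<in>S. form x y = 0}"

lemma perpD: "x \<in> perp S \<Longrightarrow> y \<in> S \<Longrightarrow> form x y = 0"
  by (simp add: perp_def)

lemma subspace_perp: "subspace (perp S)"
  by (auto simp: perp_def subspace_def form_simps)

text \<open>Pairing with a basis of \<open>S\<close> gives a map into \<open>S\<close> whose kernel
  lies in \<open>perp S\<close>; rank-nullity does the rest.\<close>

lemma dim_perp_ge:
  assumes "subspace S"
  shows "dim UNIV \<le> dim S + dim (perp S)"
proof -
  obtain B where B: "finite B" "span B = S" "independent B"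
    using basis_subspace_exists[OF assms] by metis
  let ?h = "\<lambda>x. \<Sum>b\<in>B. form x b *s b"
  have h: "lin ?h"
    by (rule linI) (simp_all add: form_simps scale_left_distrib sum.distrib scale_sum_right)
  have "?h ` UNIV \<subseteq> S"
    unfolding B(2)[symmetric] by (intro image_subsetI span_sum span_scale span_base)
  then have "dim (?h ` UNIV) \<le> dim S" by (rule dim_subset)
  moreover have "{x. ?h x = 0} \<subseteq> perp S"
  proof
    fix x assume "x \<in> {x. ?h x = 0}"
    then have "\<forall>b\<in>B. form x b = 0"
      using B(3) unfolding independent_explicit by blast
    moreover have "subspace {y. form x y = 0}" by (auto simp: subspace_def form_simps)
    ultimately have "S \<subseteq> {y. form x y = 0}"
      unfolding B(2)[symmetric] by (intro span_minimal) blast+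
    then show "x \<in> perp S" unfolding perp_def by blast
  qed
  then have "dim {x. ?h x = 0} \<le> dim (perp S)" by (rule dim_subset)
  ultimately show ?thesis using dim_image_kernel[OF h subspace_UNIV] by simp
qed

text \<open>For a complement \<open>T\<close> of \<open>S\<close>, nondegeneracy makes
  \<open>perp S\<close> and \<open>perp T\<close> independent. Their dimensions add up to at most
  the whole, while the lower bounds for both already add up to it.\<close>

lemma dim_perp:
  assumes "subspace S"
  shows "dim S + dim (perp S) = dim UNIV"
proof -
  obtain T where T: "subspace T" "dim S + dim T = dim UNIV"
    "{x + y |x y. x \<in> S \<and> y \<in> T} = UNIV"
    by (rule exists_complement[OF assms])
  have "perp S \<inter> perp T \<subseteq> {0}"
  proof
    fix x assume x: "x \<in> perp S \<inter> perp T"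
    have "form x y = 0" for y
    proof -
      have "y \<in> {x + y |x y. x \<in> S \<and> y \<in> T}" using T(3) by simp
      then obtain a b where "a \<in> S" "b \<in> T" "y = a + b" by blast
      then show ?thesis using x by (simp add: form_add perp_def)
    qed
    then have "x = 0" by (rule form_nondegenerate)
    then show "x \<in> {0}" by simp
  qed
  then have "dim (perp S) + dim (perp T) \<le> dim UNIV"
    by (intro direct_sum_dim_le subspace_perp)
  then show ?thesis
    using dim_perp_ge[OF assms] dim_perp_ge[OF T(1)] T(2) by linarith
qed

lemma perp_perp:
  assumes "subspace S"
  shows "perp (perp S) = S"
proof -
  have "S \<subseteq> perp (perp S)" by (auto simp: perp_def form_commute)
  moreover have "dim (perp (perp S)) \<le> dim S"
    using dim_perp[OF assms] dim_perp[OF subspace_perp[of S]] by linarith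
  ultimately show ?thesis
    by (intro subspace_dim_equal[symmetric] assms subspace_perp)
qed

lemma perp_separates:
  assumes "subspace S" "x \<notin> S"
  obtains q where "q \<in> perp S" "form q x \<noteq> 0"
proof -
  have "x \<notin> perp (perp S)" using perp_perp assms by simp
  then show ?thesis using that by (auto simp: perp_def form_commute)
qed

lemma form_separates: "x \<noteq> 0 \<Longrightarrow> \<exists>q. form q x \<noteq> 0"
  using form_nondegenerate form_commute by metis

text \<open>A Fredholm alternative: a vector orthogonal to the image of \<open>perp S\<close> under
  \<open>adj Y\<close> is sent by \<open>Y\<close> into \<open>S\<close>, so \<open>r\<close> lies
  in the double \<open>perp\<close> of that image.\<close>

lemma adj_solvable:
  assumes Y: "lin Y" and S: "subspace S"
    and r: "\<And>m. Y m \<in> S \<Longrightarrow> form r m = 0"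
  obtains q where "q \<in> perp S" "adj Y q = r"
proof -
  let ?I = "adj Y ` perp S"
  have sI: "subspace ?I" by (intro endo.linear_subspace_image lin_adj subspace_perp)
  have "r \<in> perp (perp ?I)"
  proof (unfold perp_def[of "perp ?I"], clarify)
    fix m assume m: "m \<in> perp ?I"
    have "Y m \<in> perp (perp S)"
      using m by (auto simp: perp_def form_adj2 Y)
    then show "form r m = 0" using r perp_perp[OF S] by simp
  qed
  then show ?thesis using that perp_perp[OF sI] by auto
qed

section \<open>Pairs of operators\<close>

definition invariant :: "('v \<Rightarrow> 'v) \<Rightarrow> ('v \<Rightarrow> 'v) \<Rightarrow> 'v set \<Rightarrow> bool" where
  "invariant X Y U \<longleftrightarrow> subspace U \<and> X ` U \<subseteq> U \<and> Y ` U \<subseteq> U"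

definition indec :: "('v \<Rightarrow> 'v) \<Rightarrow> ('v \<Rightarrow> 'v) \<Rightarrow> bool" where
  "indec X Y \<longleftrightarrow> (UNIV :: 'v set) \<noteq> {0} \<and>
     (\<forall>U W. invariant X Y U \<and> invariant X Y W \<and> U \<inter> W \<subseteq> {0} \<and> dim U + dim W = dim UNIV
        \<longrightarrow> U = {0} \<or> W = {0})"

text \<open>The form carries the dual module to the same space, where the transposes of
  \<open>X\<close> and \<open>Y\<close> become \<open>adj X\<close> and
  \<open>adj Y\<close>.\<close>

definition iso_dual :: "('v \<Rightarrow> 'v) \<Rightarrow> ('v \<Rightarrow> 'v) \<Rightarrow> bool" where
  "iso_dual X Y \<longleftrightarrow> (\<exists>\<phi>. lin \<phi> \<and> bij \<phi> \<and>
     (\<forall>x. \<phi> (X x) = adj X (\<phi> x)) \<and> (\<forall>x. \<phi> (Y x) = adj Y (\<phi> x)))"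

lemma invariant_commute: "invariant X Y = invariant Y X"
  by (auto simp: invariant_def fun_eq_iff)

lemma indec_commute: "indec X Y \<Longrightarrow> indec Y X"
  unfolding indec_def invariant_commute[of X Y] by blast

lemma iso_dual_commute: "iso_dual X Y \<Longrightarrow> iso_dual Y X"
  by (auto simp: iso_dual_def)

lemma indecD:
  assumes "indec X Y" "invariant X Y U" "invariant X Y W" "U \<inter> W \<subseteq> {0}" "dim U + dim W = dim UNIV"
  shows "U = {0} \<or> W = {0}"
  using assms unfolding indec_def by blast

lemma invariant_perp:
  assumes "lin X" "lin Y" "invariant (adj X) (adj Y) P"
  shows "invariant X Y (perp P)"
proof -
  have "T x \<in> perp P" if "lin T" "adj T ` P \<subseteq> P" "x \<in> perp P" for T x
    using that by (auto simp: perp_def form_adj2[symmetric])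
  then show ?thesis
    using assms by (auto simp: invariant_def subspace_perp)
qed

text \<open>Taking \<open>perp\<close> of both summands turns a splitting for the adjoint operators
  into a splitting for \<open>X\<close> and \<open>Y\<close>.\<close>

lemma indec_adj:
  assumes X: "lin X" and Y: "lin Y" and indec: "indec X Y"
  shows "indec (adj X) (adj Y)"
  unfolding indec_def
proof (intro conjI allI impI; (elim conjE)?)
  show "(UNIV :: 'v set) \<noteq> {0}" using indec by (simp add: indec_def)
  fix U W
  assume U: "invariant (adj X) (adj Y) U" and W: "invariant (adj X) (adj Y) W"
    and UW: "U \<inter> W \<subseteq> {0}" and d: "dim U + dim W = dim UNIV"
  have sU: "subspace U" and sW: "subspace W" using U W by (auto simp: invariant_def)
  have full: "{x + y |x y. x \<in> U \<and> y \<in> W} = UNIV"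
    using dim_direct_sum[OF sU sW UW] d sU sW by (intro subspace_eq_UNIV subspace_sums) auto
  have "perp U \<inter> perp W \<subseteq> {0}"
  proof
    fix x assume x: "x \<in> perp U \<inter> perp W"
    have "form x y = 0" for y
    proof -
      have "y \<in> {x + y |x y. x \<in> U \<and> y \<in> W}" using full by simp
      then obtain a b where "a \<in> U" "b \<in> W" "y = a + b" by blast
      then show ?thesis using x by (simp add: form_add perp_def)
    qed
    then have "x = 0" by (rule form_nondegenerate)
    then show "x \<in> {0}" by simp
  qed
  moreover have "dim (perp U) + dim (perp W) = dim UNIV"
    using dim_perp[OF sU] dim_perp[OF sW] d by linarith
  ultimately have "perp U = {0} \<or> perp W = {0}"
    by (intro indecD[OF indec] invariant_perp X Y U W)
  then have "dim U = dim UNIV \<or> dim W = dim UNIV"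
    using dim_perp[OF sU] dim_perp[OF sW] by auto
  then have "dim W = 0 \<or> dim U = 0" using d by linarith
  then show "U = {0} \<or> W = {0}" using sU sW subspace_0 dim_eq_0 by blast
qed

text \<open>The source of all direct summands below. The two trivial intersections give
  \<open>dim U \<le> dim P\<close> and \<open>dim P \<le> dim U\<close>, so \<open>perp P\<close> is
  an invariant complement of \<open>U\<close>, and indecomposability leaves no room for it.\<close>

lemma pairing_splits:
  assumes X: "lin X" and Y: "lin Y" and indec: "indec X Y"
    and U: "invariant X Y U" and P: "invariant (adj X) (adj Y) P"
    and UP: "U \<inter> perp P \<subseteq> {0}" and PU: "P \<inter> perp U \<subseteq> {0}" and nz: "\<not> U \<subseteq> {0}"
  shows "U = UNIV"
proof -
  have sU: "subspace U" and sP: "subspace P" using U P by (auto simp: invariant_def)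
  have d: "dim U + dim (perp P) = dim UNIV"
    using direct_sum_dim_le[OF sU subspace_perp UP] direct_sum_dim_le[OF sP subspace_perp PU]
      dim_perp[OF sU] dim_perp[OF sP] by linarith
  have "U = {0} \<or> perp P = {0}"
    by (intro indecD[OF indec] invariant_perp X Y U P UP d)
  then have "perp P = {0}" using nz by blast
  then have "dim UNIV \<le> dim U" using d by simp
  then show ?thesis by (intro subspace_eq_UNIV sU)
qed

lemma lin_image_span:
  assumes "lin f" "\<And>s. s \<in> S \<Longrightarrow> f s \<in> span S"
  shows "f ` span S \<subseteq> span S"
  using assms endo.linear_span_image[of f S] span_minimal[of "f ` S" "span S"] by blast

lemma span_family:
  assumes "finite I" "x \<in> span (u ` I)"
  obtains a where "x = (\<Sum>i\<in>I. a i *s u i)"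
proof -
  have "subspace {x. \<exists>a. x = (\<Sum>i\<in>I. a i *s u i)}"
  proof (rule subspaceI)
    show "0 \<in> {x. \<exists>a. x = (\<Sum>i\<in>I. a i *s u i)}"
      by (auto intro: exI[of _ "\<lambda>_. 0"])
    fix x y assume "x \<in> {x. \<exists>a. x = (\<Sum>i\<in>I. a i *s u i)}" "y \<in> {x. \<exists>a. x = (\<Sum>i\<in>I. a i *s u i)}"
    then obtain a b where "x = (\<Sum>i\<in>I. a i *s u i)" "y = (\<Sum>i\<in>I. b i *s u i)" by blast
    then have "x + y = (\<Sum>i\<in>I. (a i + b i) *s u i)"
      by (simp add: scale_left_distrib sum.distrib)
    then show "x + y \<in> {x. \<exists>a. x = (\<Sum>i\<in>I. a i *s u i)}"
      by (auto intro: exI[of _ "\<lambda>i. a i + b i"])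
  next
    fix c x assume "x \<in> {x. \<exists>a. x = (\<Sum>i\<in>I. a i *s u i)}"
    then obtain a where "x = (\<Sum>i\<in>I. a i *s u i)" by blast
    then have "c *s x = (\<Sum>i\<in>I. (c * a i) *s u i)" by (simp add: scale_sum_right)
    then show "c *s x \<in> {x. \<exists>a. x = (\<Sum>i\<in>I. a i *s u i)}"
      by (auto intro: exI[of _ "\<lambda>i. c * a i"])
  qed
  moreover have "u ` I \<subseteq> {x. \<exists>a. x = (\<Sum>i\<in>I. a i *s u i)}"
  proof clarify
    fix i assume "i \<in> I"
    have "(\<Sum>j\<in>I. (if i = j then 1 else 0) *s u j) = (\<Sum>j\<in>I. if i = j then u j else 0)"
      by (intro sum.cong) auto
    then have "u i = (\<Sum>j\<in>I. (if i = j then 1 else 0) *s u j)"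
      using \<open>i \<in> I\<close> \<open>finite I\<close> by simp
    then show "\<exists>a. u i = (\<Sum>j\<in>I. a j *s u j)"
      by (rule exI[of _ "\<lambda>j. if i = j then 1 else 0"])
  qed
  ultimately show ?thesis using span_minimal assms(2) that by blast
qed

section \<open>Fitting's lemma and modules cyclic over a commutative algebra\<close>

lemma fitting:
  assumes X: "lin X" and Y: "lin Y" and indec: "indec X Y" and F: "lin F"
    and FX: "\<And>x. F (X x) = X (F x)" and FY: "\<And>x. F (Y x) = Y (F x)"
  shows "(\<exists>n. \<forall>x. (F ^^ n) x = 0) \<or> (\<forall>x. F x = 0 \<longrightarrow> x = 0)"
proof -
  let ?K = "\<lambda>n. {x. (F ^^ n) x = 0}"
  have Fn: "lin (F ^^ n)" for n using F by (rule lin_funpow)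
  have sK: "subspace (?K n)" for n using Fn by (rule endo.linear_subspace_kernel)
  have "dim (?K n) \<le> dim UNIV" for n by (intro dim_subset subset_UNIV)
  \<comment> \<open>The kernels of the powers increase with bounded dimension, so one of them is
    largest. The existence rule asks for a strict bound, hence the \<open>Suc\<close>.\<close>
  then have "\<exists>N. True \<and> (\<forall>n. True \<longrightarrow> dim (?K n) \<le> dim (?K N))"
    by (intro ex_has_greatest_nat[of _ 0 _ "Suc (dim UNIV)"]) (simp_all add: less_Suc_eq_le del: dim_UNIV)
  then obtain N where N: "\<And>n. dim (?K n) \<le> dim (?K N)" by blast
  \<comment> \<open>Once the kernels are stationary, the kernel and the range of
    \<open>F ^^ N\<close> meet trivially and split the module.\<close>
  have "?K N = ?K (N + N)"
  proof (rule subspace_dim_equal[OF sK sK _ N])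
    show "?K N \<subseteq> ?K (N + N)" using endo.linear_0[OF Fn] by (auto simp: funpow_add)
  qed
  then have KN: "(F ^^ N) ((F ^^ N) x) = 0 \<Longrightarrow> (F ^^ N) x = 0" for x
    by (auto simp: funpow_add)
  have comm: "(F ^^ n) (X x) = X ((F ^^ n) x)" "(F ^^ n) (Y x) = Y ((F ^^ n) x)" for n x
    by (induction n) (simp_all add: FX FY)
  have "?K N = {0} \<or> range (F ^^ N) = {0}"
  proof (rule indecD[OF indec])
    show "invariant X Y (?K N)"
      using sK by (auto simp: invariant_def comm endo.linear_0 X Y)
    have "X ((F ^^ N) x) \<in> range (F ^^ N)" "Y ((F ^^ N) x) \<in> range (F ^^ N)" for x
      by (metis comm rangeI)+
    then show "invariant X Y (range (F ^^ N))"
      by (auto simp: invariant_def intro: endo.linear_subspace_image[OF Fn])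
    show "?K N \<inter> range (F ^^ N) \<subseteq> {0}" using KN by auto
    show "dim (?K N) + dim (range (F ^^ N)) = dim UNIV"
      using dim_image_kernel[OF Fn subspace_UNIV, of N] by simp
  qed
  then show ?thesis
  proof
    assume K: "?K N = {0}"
    have "dim (?K 1) = 0" using N[of 1] unfolding K by simp
    then have "?K 1 \<subseteq> {0}" unfolding dim_eq_0 .
    then show ?thesis by auto
  next
    assume "range (F ^^ N) = {0}"
    then show ?thesis by (intro disjI1 exI[of _ N]) (metis rangeI singletonD)
  qed
qed

lemma bij_of_inj:
  assumes "lin f" "\<And>x. f x = 0 \<Longrightarrow> x = 0"
  shows "bij f"
proof -
  have "inj f" using assms endo.linear_inj_iff_eq_0 by blast
  then show ?thesis using linear_inj_imp_surj[OF assms(1)] by (simp add: bij_def)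
qed

text \<open>The functional \<open>form q (a v)\<close> makes the commutative algebra
  \<open>A\<close> a Frobenius algebra. Then the orbit of \<open>v\<close> under \<open>A\<close>
  and the orbit of \<open>q\<close> under the adjoints pair perfectly. So the orbit of
  \<open>v\<close> is everything, and sending \<open>a v\<close> to \<open>adj a q\<close> is the
  isomorphism with the dual.\<close>

lemma iso_dual_cyclic:
  assumes X: "lin X" and Y: "lin Y" and indec: "indec X Y"
    and A_lin: "\<And>a. a \<in> A \<Longrightarrow> lin a"
    and A_comm: "\<And>a b x. a \<in> A \<Longrightarrow> b \<in> A \<Longrightarrow> a (b x) = b (a x)"
    and A_comp: "\<And>a b. a \<in> A \<Longrightarrow> b \<in> A \<Longrightarrow> (\<lambda>x. a (b x)) \<in> A"
    and A_add: "\<And>a b. a \<in> A \<Longrightarrow> b \<in> A \<Longrightarrow> (\<lambda>x. a x + b x) \<in> A"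
    and A_scale: "\<And>a c. a \<in> A \<Longrightarrow> (\<lambda>x. c *s a x) \<in> A"
    and A_id: "(\<lambda>x. x) \<in> A" and A_X: "X \<in> A" and A_Y: "Y \<in> A"
    and nondeg: "\<And>a. a \<in> A \<Longrightarrow> (\<And>b. b \<in> A \<Longrightarrow> form q (b (a v)) = 0) \<Longrightarrow> (\<And>x. a x = 0)"
  shows "iso_dual X Y"
proof -
  let ?U = "(\<lambda>a. a v) ` A" and ?P = "(\<lambda>a. adj a q) ` A"
  have A_zero: "(\<lambda>x. 0) \<in> A" using A_scale[OF A_id, of 0] by simp
  have A_diff: "(\<lambda>x. a x - b x) \<in> A" if "a \<in> A" "b \<in> A" for a b
    using A_add[OF that(1) A_scale[OF that(2), of "- 1"]] by simp
  have adj_add: "adj a q + adj b q = adj (\<lambda>x. a x + b x) q" if "a \<in> A" "b \<in> A" for a b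
    by (rule form_eqI) (simp add: form_simps form_adj A_lin A_add that)
  have adj_scale: "c *s adj a q = adj (\<lambda>x. c *s a x) q" if "a \<in> A" for a c
    by (rule form_eqI) (simp add: form_simps form_adj A_lin A_scale that)
  have adj_comp: "adj b (adj a q) = adj (\<lambda>x. b (a x)) q" if "a \<in> A" "b \<in> A" for a b
    by (rule form_eqI) (simp add: form_adj A_lin A_comp A_comm[OF that] that)
  have adj_zero: "adj (\<lambda>x. 0) q = 0"
    by (rule form_eqI) (simp add: form_adj A_lin A_zero)
  have "?U = UNIV"
  proof (rule pairing_splits[OF X Y indec, of _ ?P])
    show "invariant X Y ?U"
      unfolding invariant_def
    proof (intro conjI)
      show "subspace ?U" unfolding subspace_def
      proof (intro conjI ballI allI; clarsimp?)
        show "0 \<in> ?U" using A_zero by (rule rev_image_eqI) simp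
        show "a v + b v \<in> ?U" if "a \<in> A" "b \<in> A" for a b
          using A_add[OF that] by (rule rev_image_eqI) simp
        show "c *s a v \<in> ?U" if "a \<in> A" for a c
          using A_scale[OF that, of c] by (rule rev_image_eqI) simp
      qed
      show "X ` ?U \<subseteq> ?U"
      proof clarify
        fix a assume "a \<in> A"
        from A_comp[OF A_X this] show "X (a v) \<in> ?U" by (rule rev_image_eqI) simp
      qed
      show "Y ` ?U \<subseteq> ?U"
      proof clarify
        fix a assume "a \<in> A"
        from A_comp[OF A_Y this] show "Y (a v) \<in> ?U" by (rule rev_image_eqI) simp
      qed
    qed
    show "invariant (adj X) (adj Y) ?P"
      unfolding invariant_def
    proof (intro conjI)
      show "subspace ?P" unfolding subspace_def
      proof (intro conjI ballI allI; clarsimp?)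
        show "0 \<in> ?P" using A_zero by (rule rev_image_eqI) (simp add: adj_zero)
        show "adj a q + adj b q \<in> ?P" if "a \<in> A" "b \<in> A" for a b
          using A_add[OF that] by (rule rev_image_eqI) (simp add: adj_add that)
        show "c *s adj a q \<in> ?P" if "a \<in> A" for a c
          using A_scale[OF that, of c] by (rule rev_image_eqI) (simp add: adj_scale that)
      qed
      show "adj X ` ?P \<subseteq> ?P"
      proof clarify
        fix a assume "a \<in> A"
        from A_comp[OF A_X this] show "adj X (adj a q) \<in> ?P"
          by (rule rev_image_eqI) (simp add: adj_comp \<open>a \<in> A\<close> A_X)
      qed
      show "adj Y ` ?P \<subseteq> ?P"
      proof clarify
        fix a assume "a \<in> A"
        from A_comp[OF A_Y this] show "adj Y (adj a q) \<in> ?P"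
          by (rule rev_image_eqI) (simp add: adj_comp \<open>a \<in> A\<close> A_Y)
      qed
    qed
    show "?U \<inter> perp ?P \<subseteq> {0}"
    proof clarify
      fix a assume a: "a \<in> A" and p: "a v \<in> perp ?P"
      have "form q (b (a v)) = 0" if "b \<in> A" for b
        using perpD[OF p, of "adj b q"] that by (simp add: form_adj2 form_commute A_lin)
      then show "a v = 0" using nondeg[OF a] by blast
    qed
    show "?P \<inter> perp ?U \<subseteq> {0}"
    proof clarify
      fix a assume a: "a \<in> A" and p: "adj a q \<in> perp ?U"
      have "form q (b (a v)) = 0" if "b \<in> A" for b
        using perpD[OF p, of "b v"] that a by (simp add: form_adj A_comm A_lin)
      then have "a x = 0" for x using nondeg[OF a] by blast
      then have "a = (\<lambda>x. 0)" by blast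
      then show "adj a q = 0" by (simp add: adj_zero)
    qed
    show "\<not> ?U \<subseteq> {0}"
    proof
      assume *: "?U \<subseteq> {0}"
      have "v = 0" using * A_id by blast
      \<comment> \<open>With \<open>v = 0\<close>, nondegeneracy at the identity operator would
        annihilate the whole space.\<close>
      then have "form q (b v) = 0" if "b \<in> A" for b
        using endo.linear_0[OF A_lin[OF that]] by simp
      then have "x = 0" for x :: 'v by (rule nondeg[OF A_id])
      then show False using indec unfolding indec_def by blast
    qed
  qed
  then have ex: "\<exists>a\<in>A. a v = m" for m by (metis UNIV_I imageE)
  have unique: "a = b" if "a \<in> A" "b \<in> A" "a v = b v" for a b
  proof -
    have "form q (c (a v - b v)) = 0" if "c \<in> A" for c
      using \<open>a v = b v\<close> endo.linear_0[OF A_lin[OF that]] by simp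
    then have "a x - b x = 0" for x
      using nondeg[OF A_diff[OF that(1,2)]] by blast
    then show ?thesis by auto
  qed
  \<comment> \<open>\<open>\<alpha> m\<close> is the only operator in \<open>A\<close> that sends
    \<open>v\<close> to \<open>m\<close>; uniqueness is what makes \<open>\<phi>\<close> linear and
    equivariant.\<close>
  obtain \<alpha> where \<alpha>: "\<And>m. \<alpha> m \<in> A" "\<And>m. \<alpha> m v = m" using ex by metis
  have \<alpha>_eq: "\<alpha> m = a" if "a \<in> A" "a v = m" for a m using unique \<alpha> that by blast
  define \<phi> where "\<phi> m = adj (\<alpha> m) q" for m
  have lin\<phi>: "lin \<phi>"
  proof (rule linI)
    fix m n c
    have "\<alpha> (m + n) = (\<lambda>x. \<alpha> m x + \<alpha> n x)" by (rule \<alpha>_eq) (simp_all add: A_add \<alpha>)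
    then show "\<phi> (m + n) = \<phi> m + \<phi> n" by (simp add: \<phi>_def adj_add \<alpha>)
    have "\<alpha> (c *s m) = (\<lambda>x. c *s \<alpha> m x)" by (rule \<alpha>_eq) (simp_all add: A_scale \<alpha>)
    then show "\<phi> (c *s m) = c *s \<phi> m" by (simp add: \<phi>_def adj_scale \<alpha>)
  qed
  have "bij \<phi>"
  proof (rule bij_of_inj[OF lin\<phi>])
    fix m assume "\<phi> m = 0"
    then have "form q (\<alpha> m x) = 0" for x
      using form_adj[of "\<alpha> m" q x] A_lin \<alpha> by (simp add: \<phi>_def)
    then have "form q (b (\<alpha> m v)) = 0" if "b \<in> A" for b
      using A_comm[OF that \<alpha>(1)] by simp
    then have "\<alpha> m v = 0" using nondeg[OF \<alpha>(1)] by blast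
    then show "m = 0" by (simp add: \<alpha>)
  qed
  moreover have "\<phi> (b m) = adj b (\<phi> m)" if "b \<in> A" for b m
  proof -
    have "\<alpha> (b m) = (\<lambda>x. b (\<alpha> m x))" by (rule \<alpha>_eq) (simp_all add: A_comp \<alpha> that)
    then show ?thesis by (simp add: \<phi>_def adj_comp \<alpha> that)
  qed
  ultimately show ?thesis using lin\<phi> A_X A_Y unfolding iso_dual_def by blast
qed

section \<open>The cyclic cases\<close>

definition poly_map :: "('v \<Rightarrow> 'v) \<Rightarrow> 'k poly \<Rightarrow> 'v \<Rightarrow> 'v" where
  "poly_map T f x = (\<Sum>i\<le>degree f. coeff f i *s (T ^^ i) x)"

lemma poly_map_0 [simp]: "poly_map T 0 x = 0"
  by (simp add: poly_map_def)

lemma poly_map_pCons [simp]: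
  assumes "lin T"
  shows "poly_map T (pCons a f) x = a *s x + T (poly_map T f x)"
proof (cases "f = 0")
  case True
  then show ?thesis using endo.linear_0[OF assms] by (simp add: poly_map_def)
next
  case False
  then show ?thesis
    using assms by (simp add: poly_map_def sum.atMost_Suc_shift endo.linear_sum endo.linear_scale del: sum.atMost_Suc)
qed

lemma lin_poly_map: "lin T \<Longrightarrow> lin (poly_map T f)"
  unfolding poly_map_def
  by (rule linI) (simp_all add: endo.linear_add[OF lin_funpow] endo.linear_scale[OF lin_funpow]
      scale_right_distrib sum.distrib scale_sum_right mult.commute)

lemma poly_map_add: "lin T \<Longrightarrow> poly_map T (f + g) x = poly_map T f x + poly_map T g x"
  by (induction f g rule: poly_induct2) (simp_all add: endo.linear_add scale_left_distrib)

lemma poly_map_smult: "lin T \<Longrightarrow> poly_map T (smult c f) x = c *s poly_map T f x"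
  by (induction f) (simp_all add: endo.linear_scale scale_right_distrib)

lemma poly_map_diff: "lin T \<Longrightarrow> poly_map T (f - g) x = poly_map T f x - poly_map T g x"
  using poly_map_add[of T "f - g" g x] by simp

lemma poly_map_mult: "lin T \<Longrightarrow> poly_map T (f * g) x = poly_map T f (poly_map T g x)"
  by (induction f) (simp_all add: poly_map_add poly_map_smult)

lemma poly_map_1 [simp]: "lin T \<Longrightarrow> poly_map T 1 x = x"
  by (simp add: one_pCons endo.linear_0)

lemma poly_map_monom: "lin T \<Longrightarrow> poly_map T (monom c n) x = c *s (T ^^ n) x"
  by (induction n) (simp_all add: monom_0 monom_Suc endo.linear_0 endo.linear_scale)

lemma poly_map_sum: "lin T \<Longrightarrow> poly_map T (sum f A) x = (\<Sum>a\<in>A. poly_map T (f a) x)"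
  by (induction A rule: infinite_finite_induct) (simp_all add: poly_map_add)

lemma poly_map_power: "lin T \<Longrightarrow> (poly_map T f ^^ n) x = poly_map T (f ^ n) x"
  by (induction n arbitrary: x) (simp_all add: poly_map_mult)

lemma poly_map_commute:
  assumes "lin T" "lin F" "\<And>x. F (T x) = T (F x)"
  shows "F (poly_map T f x) = poly_map T f (F x)"
  by (induction f) (simp_all add: assms endo.linear_0 endo.linear_add endo.linear_scale)

lemma poly_map_comm: "lin T \<Longrightarrow> poly_map T f (poly_map T g x) = poly_map T g (poly_map T f x)"
  by (simp add: poly_map_mult[symmetric] mult.commute)

text \<open>Otherwise the vectors \<open>(T ^^ i) x\<close> for \<open>i\<close> from 0 to
  \<open>dim UNIV\<close> are independent, one more than the dimension allows. Independence is a
  property of sets, so these vectors must first be shown distinct.\<close>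

lemma poly_map_eigen:
  assumes T: "lin T" and x: "x \<noteq> 0"
  obtains f where "f \<noteq> 0" "poly_map T f x = 0"
proof (rule ccontr)
  assume "\<not> thesis"
  then have *: "poly_map T f x = 0 \<Longrightarrow> f = 0" for f using that by blast
  let ?u = "\<lambda>i. (T ^^ i) x" and ?n = "dim UNIV"
  have inj: "inj ?u"
  proof (rule injI)
    fix i j assume "?u i = ?u j"
    then have "monom 1 i - monom (1 :: 'k) j = 0"
      by (intro *) (simp add: poly_map_diff poly_map_monom T)
    then have "monom (1 :: 'k) i = monom 1 j" by simp
    then have "coeff (monom (1 :: 'k) i) i = coeff (monom 1 j) i" by (rule arg_cong)
    then show "i = j" by (simp split: if_splits)
  qed
  have "independent (?u ` {..?n})"
    unfolding independent_explicit
  proof (intro conjI allI impI ballI)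
    fix c v assume c: "(\<Sum>v\<in>?u ` {..?n}. c v *s v) = 0" and v: "v \<in> ?u ` {..?n}"
    have "(\<Sum>i\<in>{..?n}. c (?u i) *s ?u i) = 0"
      using c by (subst (asm) sum.reindex[OF inj_on_subset[OF inj subset_UNIV]]) simp
    then have "(\<Sum>i\<in>{..?n}. monom (c (?u i)) i) = 0"
      by (intro *) (simp add: poly_map_sum poly_map_monom T)
    then have z: "coeff (\<Sum>i\<in>{..?n}. monom (c (?u i)) i) j = 0" for j by simp
    obtain j where j: "j \<le> ?n" "v = ?u j" using v by blast
    have "coeff (\<Sum>i\<in>{..?n}. monom (c (?u i)) i) j = c (?u j)"
      using j(1) by (simp add: coeff_sum del: dim_UNIV)
    with z j show "c v = 0" by simp
  qed simp
  then have "card (?u ` {..?n}) \<le> ?n"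
    by (intro independent_card_le_dim subset_UNIV)
  then show False
    using card_image[OF inj_on_subset[OF inj subset_UNIV], of "{..?n}"] by simp
qed

text \<open>Splits off the full power of \<open>p\<close>; a factor \<open>p\<close> of positive
  degree lowers the degree, so the division ends.\<close>

lemma poly_power_factor:
  fixes p f :: "'k poly"
  assumes p: "degree p > 0"
  shows "f \<noteq> 0 \<Longrightarrow> \<exists>j h. f = p ^ j * h \<and> \<not> p dvd h"
proof (induction "degree f" arbitrary: f rule: less_induct)
  case less
  show ?case
  proof (cases "p dvd f")
    case False
    then show ?thesis by (intro exI[of _ 0] exI[of _ f]) simp
  next
    case True
    then obtain g where g: "f = p * g" by (rule dvdE)
    with less.prems have "g \<noteq> 0" "p \<noteq> 0" by auto
    then have "degree g < degree f" using p by (simp add: g degree_mult_eq)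
    from less.hyps[OF this \<open>g \<noteq> 0\<close>] obtain j h where "g = p ^ j * h" "\<not> p dvd h" by blast
    then show ?thesis by (intro exI[of _ "Suc j"] exI[of _ h]) (simp add: g mult.assoc)
  qed
qed

lemma inj_on_subspace_onto:
  assumes F: "lin F" and Z: "subspace Z" and FZ: "F ` Z \<subseteq> Z" and inj: "\<And>x. x \<in> Z \<Longrightarrow> F x = 0 \<Longrightarrow> x = 0"
  shows "F ` Z = Z"
proof (rule subspace_dim_equal[OF _ Z FZ])
  show "subspace (F ` Z)" using F Z by (rule endo.linear_subspace_image)
  have "dim {x \<in> Z. F x = 0} = 0" using inj by (subst dim_eq_0) blast
  then show "dim Z \<le> dim (F ` Z)" using dim_image_kernel[OF F Z] by linarith
qed

section \<open>Modules with ker X = im X\<close>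

text \<open>\<open>X\<close> is viewed as the differential of an exact complex, and
  \<open>\<sigma>\<close> is a contraction of it, normalised to have square zero.\<close>

lemma contracting_homotopy:
  assumes X: "lin X" and XX: "\<And>x. X (X x) = 0" and exact: "\<And>x. X x = 0 \<Longrightarrow> x \<in> range X"
  obtains \<sigma> where "lin \<sigma>" "\<And>x. \<sigma> (X x) + X (\<sigma> x) = x" "\<And>x. \<sigma> (\<sigma> x) = 0"
proof -
  obtain g where "range g \<subseteq> UNIV \<and> lin g \<and> (\<forall>v\<in>range X. X (g v) = v)"
    using endo.linear_exists_right_inverse_on[OF X subspace_UNIV] by (rule exE)
  then have g: "lin g" and gX: "X (g (X x)) = X x" for x by (iprover, metis rangeI)
  note X_simps = endo.linear_diff[OF X] endo.linear_0[OF X]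
  \<comment> \<open>For \<open>g X g\<close> both \<open>X s X = X\<close> and
    \<open>s X s = s\<close> hold; the right inverse \<open>g\<close> alone guarantees only the
    first.\<close>
  define s where "s x = g (X (g x))" for x
  have s: "lin s" unfolding s_def by (rule lin_comp[OF g lin_comp[OF X g]])
  have 1: "X (s (X x)) = X x" for x by (simp add: s_def gX)
  have 2: "s (X (s x)) = s x" for x by (simp add: s_def gX)
  have 3: "X (s x) = x" if "X x = 0" for x using 1 exact[OF that] by auto
  \<comment> \<open>The vector \<open>x - s (X x)\<close> lies in ker X = im X, where
    \<open>X s\<close> is the identity. Together with \<open>s X s = s\<close> this gives square
    zero.\<close>
  define \<sigma> where "\<sigma> x = s (x - s (X x))" for x
  have X\<sigma>: "X (\<sigma> x) = x - s (X x)" for x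
    unfolding \<sigma>_def by (rule 3) (simp add: X_simps 1)
  show ?thesis
  proof
    show "lin \<sigma>" using s X unfolding \<sigma>_def by (simp add: lin_iff endo.linear_diff)
        (metis (no_types, lifting) add_diff_add scale_right_diff_distrib)
    show "\<sigma> (X x) + X (\<sigma> x) = x" for x
      unfolding X\<sigma> by (simp add: \<sigma>_def XX endo.linear_0[OF s])
    have "s (X (\<sigma> x)) = \<sigma> x" for x unfolding \<sigma>_def by (rule 2)
    then show "\<sigma> (\<sigma> x) = 0" for x
      unfolding \<sigma>_def[of "\<sigma> x"] by (simp add: endo.linear_0[OF s])
  qed
qed

lemma iso_dual_exact:
  assumes X: "lin X" and Y: "lin Y" and indec: "indec X Y"
    and XX: "\<And>x. X (X x) = 0" and XY: "\<And>x. X (Y x) = 0" and YX: "\<And>x. Y (X x) = 0"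
    and exact: "\<And>x. X x = 0 \<Longrightarrow> x \<in> range X"
  shows "iso_dual X Y"
proof -
  obtain \<sigma> where \<sigma>: "lin \<sigma>" and homotopy: "\<And>x. \<sigma> (X x) + X (\<sigma> x) = x" and \<sigma>\<sigma>: "\<And>x. \<sigma> (\<sigma> x) = 0"
    using contracting_homotopy[OF X XX exact] by blast
  \<comment> \<open>The anticommutator of \<open>Y\<close> with the homotopy:
    \<open>Y = X T = T X\<close>, and square zero of \<open>\<sigma>\<close> makes \<open>T\<close>
    commute with \<open>\<sigma>\<close>.\<close>
  define T where "T x = \<sigma> (Y x) + Y (\<sigma> x)" for x
  have T: "lin T"
    using \<sigma> Y by (simp add: T_def lin_iff scale_right_distrib algebra_simps)
  have XT: "X (T x) = Y x" for x
    using homotopy[of "Y x"] by (simp add: T_def endo.linear_add[OF X] XY endo.linear_0[OF \<sigma>])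
  have TX: "T (X x) = Y x" for x
  proof -
    have "Y x = Y (\<sigma> (X x) + X (\<sigma> x))" by (simp add: homotopy)
    also have "\<dots> = Y (\<sigma> (X x))" by (simp add: endo.linear_add[OF Y] YX)
    finally show ?thesis by (simp add: T_def YX endo.linear_0[OF \<sigma>])
  qed
  have \<sigma>T: "\<sigma> (T x) = T (\<sigma> x)" for x
    by (simp add: T_def \<sigma>\<sigma> endo.linear_add[OF \<sigma>] endo.linear_0[OF Y])
  let ?e = "poly_map T"
  note e_lin = lin_poly_map[OF T] and e_mult = poly_map_mult[OF T]
  have eX: "?e f (X x) = X (?e f x)" for f x
    using poly_map_commute[OF T X] XT TX by simp
  have e\<sigma>: "?e f (\<sigma> x) = \<sigma> (?e f x)" for f x
    using poly_map_commute[OF T \<sigma>] \<sigma>T by simp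
  have eT: "?e f (T x) = T (?e f x)" for f x
    using poly_map_commute[OF T T] by simp
  have eY: "?e f (Y x) = Y (?e f x)" for f x
    by (simp add: XT[symmetric] eX eT)
  have nz: "\<exists>x :: 'v. x \<noteq> 0" using indec unfolding indec_def by blast
  \<comment> \<open>\<open>p\<close> is to be an irreducible factor of the minimal polynomial of
    \<open>T\<close>. It is found as a nonzero polynomial of least degree whose value at
    \<open>T\<close> is not injective.\<close>
  let ?bad = "\<lambda>f. f \<noteq> 0 \<and> (\<exists>x. x \<noteq> 0 \<and> ?e f x = 0)"
  have "\<exists>f. ?bad f"
    using nz poly_map_eigen[OF T] by metis
  then obtain p where p: "?bad p" and p_min: "\<And>f. ?bad f \<Longrightarrow> degree p \<le> degree f"
    using ex_has_least_nat[of ?bad _ degree] by blast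
  have "degree p > 0"
  proof (rule ccontr)
    assume "\<not> degree p > 0"
    then obtain c where "p = [:c:]" using degree_eq_zeroE by blast
    then show False using p by (auto simp: T endo.linear_0[OF T])
  qed
  \<comment> \<open>By Fitting's lemma \<open>p\<close> is nilpotent at \<open>T\<close>, since it
    is not injective there. The least vanishing exponent is \<open>n = Suc m\<close>.\<close>
  have "(\<exists>n. \<forall>x. (?e p ^^ n) x = 0) \<or> (\<forall>x. ?e p x = 0 \<longrightarrow> x = 0)"
    using eX eY by (intro fitting[OF X Y indec e_lin])
  then have "\<exists>n. \<forall>x. ?e (p ^ n) x = 0"
    using p unfolding poly_map_power[OF T] by blast
  then obtain n where n: "\<And>x. ?e (p ^ n) x = 0" and n_min: "\<And>i. i < n \<Longrightarrow> \<exists>x. ?e (p ^ i) x \<noteq> 0"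
    using exists_least_iff[of "\<lambda>n. \<forall>x. ?e (p ^ n) x = 0"] by blast
  have "n \<noteq> 0" using n nz T by (metis poly_map_1 power_0)
  then obtain m where m: "n = Suc m" by (cases n) auto
  obtain x0 where x0: "?e (p ^ m) x0 \<noteq> 0" using n_min[of m] m by auto
  \<comment> \<open>If \<open>p ^ m\<close> at \<open>T\<close> killed the image of
    \<open>X\<close>, it would kill everything: it commutes with \<open>\<sigma>\<close>, and the
    homotopy writes each vector through values of \<open>X\<close>.\<close>
  have "\<exists>v. ?e (p ^ m) (X v) \<noteq> 0"
  proof (rule ccontr)
    assume "\<not> ?thesis"
    then have *: "?e (p ^ m) (X v) = 0" for v by blast
    have "?e (p ^ m) x0 = \<sigma> (?e (p ^ m) (X x0)) + ?e (p ^ m) (X (\<sigma> x0))"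
      unfolding e\<sigma>[symmetric] endo.linear_add[OF e_lin, symmetric] homotopy ..
    then show False using x0 * by (simp add: endo.linear_0[OF \<sigma>])
  qed
  then obtain v where v: "?e (p ^ m) (X v) \<noteq> 0" by blast
  then obtain q where q: "form q (?e (p ^ m) (X v)) \<noteq> 0" using form_separates by blast
  \<comment> \<open>If \<open>h\<close> had a kernel vector, multiplying it by a power of
    \<open>p\<close> would give a nonzero \<open>y\<close> killed by \<open>h\<close> and by
    \<open>p\<close>, hence by \<open>h mod p\<close>, against the least degree of
    \<open>p\<close>.\<close>
  have coprime_inj: "x = 0" if h: "\<not> p dvd h" and hx: "?e h x = 0" for h x
  proof (rule ccontr)
    assume x: "x \<noteq> 0"
    have "\<exists>i. ?e (p ^ i) x = 0" using n by blast
    then obtain i where i: "?e (p ^ i) x = 0" "\<And>j. j < i \<Longrightarrow> ?e (p ^ j) x \<noteq> 0"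
      using exists_least_iff[of "\<lambda>i. ?e (p ^ i) x = 0"] by blast
    have "i \<noteq> 0" using i(1) x T by (metis poly_map_1 power_0)
    then obtain l where l: "i = Suc l" by (cases i) auto
    define y where "y = ?e (p ^ l) x"
    have y: "y \<noteq> 0" using i(2) l by (simp add: y_def)
    have py: "?e p y = 0" using i(1) by (simp add: y_def l e_mult)
    have hy: "?e h y = 0"
      unfolding y_def using poly_map_comm[OF T, of h "p ^ l" x] hx by (simp add: endo.linear_0[OF e_lin])
    have "?e (h mod p) y = ?e h y - ?e (h div p) (?e p y)"
      unfolding e_mult[symmetric] poly_map_diff[OF T, symmetric] by (simp add: minus_div_mult_eq_mod)
    then have "?e (h mod p) y = 0" by (simp add: py hy endo.linear_0[OF e_lin])
    moreover have "h mod p \<noteq> 0" using h by (simp add: dvd_eq_mod_eq_0)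
    ultimately have "degree p \<le> degree (h mod p)" using p_min y by blast
    then show False
      using degree_mod_less[of p h] \<open>h mod p \<noteq> 0\<close> p by auto
  qed
  \<comment> \<open>The functional \<open>form q\<close> detects on \<open>X v\<close> every
    polynomial that is nonzero at \<open>T\<close>: such an \<open>f\<close> has a multiple that
    takes \<open>X v\<close> to \<open>p ^ m\<close> applied to \<open>X v\<close>, where
    \<open>q\<close> does not vanish.\<close>
  have key: "?e f x = 0" if f: "\<And>h. form q (?e h (?e f (X v))) = 0" for f x
  proof (cases "f = 0")
    case True
    then show ?thesis by simp
  next
    case False
    then obtain j h where jh: "f = p ^ j * h" "\<not> p dvd h"
      using poly_power_factor[OF \<open>degree p > 0\<close>] by blast
    show ?thesis
    proof (cases "j \<le> m")
      case False
      then have "p ^ j = p ^ (j - n) * p ^ n" by (simp add: m flip: power_add del: power_Suc)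
      then have "f = p ^ (j - n) * h * p ^ n" by (simp add: jh mult.commute mult.left_commute)
      then show ?thesis by (simp add: e_mult n endo.linear_0[OF e_lin])
    next
      case True
      define z where "z = ?e (p ^ m) (X v)"
      \<comment> \<open>\<open>h\<close> is injective on the finite-dimensional space of polynomial
        multiples of \<open>z\<close>, hence onto. So a polynomial \<open>g\<close> inverts
        \<open>h\<close> at \<open>z\<close>.\<close>
      let ?Z = "range (\<lambda>g. ?e g z)"
      have "?e h ` ?Z = ?Z"
      proof (rule inj_on_subspace_onto[OF e_lin])
        show "subspace ?Z"
        proof (rule subspaceI)
          show "0 \<in> ?Z" by (rule range_eqI[of _ _ 0]) simp
          show "x + y \<in> ?Z" if "x \<in> ?Z" "y \<in> ?Z" for x y
            using that by (auto simp: poly_map_add[OF T, symmetric])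
          show "c *s x \<in> ?Z" if "x \<in> ?Z" for c x
            using that by (auto simp: poly_map_smult[OF T, symmetric])
        qed
        show "?e h ` ?Z \<subseteq> ?Z" by (auto simp: e_mult[symmetric])
        show "x = 0" if "?e h x = 0" for x using coprime_inj[OF jh(2) that] .
      qed
      moreover have "z \<in> ?Z" by (rule range_eqI[of _ _ 1]) (simp add: T)
      ultimately have "z \<in> ?e h ` ?Z" by simp
      then have "\<exists>g. z = ?e h (?e g z)" by (simp only: image_image image_iff bex_UNIV)
      then obtain g where g: "?e h (?e g z) = z" by (elim exE) (rule that, rule sym)
      have "p ^ (m - j) * p ^ j = p ^ m" using True by (simp add: power_add[symmetric])
      then have "(g * p ^ (m - j)) * f = h * (g * p ^ m)"
        unfolding jh by (metis mult.assoc mult.commute)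
      then have "?e (g * p ^ (m - j)) (?e f (X v)) = ?e (h * (g * p ^ m)) (X v)"
        unfolding e_mult[symmetric] by (rule arg_cong)
      then have "?e (g * p ^ (m - j)) (?e f (X v)) = z"
        unfolding e_mult[of h] e_mult[of g "p ^ m"] z_def[symmetric] g .
      then show ?thesis using f q by (metis z_def)
    qed
  qed
  let ?a = "\<lambda>f g x. ?e f x + ?e g (X x)"
  let ?A = "{?a f g | f g. True}"
  show ?thesis
  proof (rule iso_dual_cyclic[OF X Y indec, of ?A q v])
    show "lin a" if "a \<in> ?A" for a
      using that lin_poly_map[OF T] lin_comp[OF lin_poly_map[OF T] X] by (auto intro: endo.linear_compose_add)
    have comp: "?a f g (?a f' g' x) = ?a (f * f') (f * g' + g * f') x" for f g f' g' x
      by (simp add: poly_map_add[OF T] e_mult endo.linear_add[OF e_lin] endo.linear_add[OF X] eX XX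
          endo.linear_0[OF e_lin])
    show "a (b x) = b (a x)" if "a \<in> ?A" "b \<in> ?A" for a b x
      using that by (auto simp: comp mult.commute add.commute)
    have mem: "?a f g \<in> ?A" for f g by blast
    show "(\<lambda>x. a (b x)) \<in> ?A" if "a \<in> ?A" "b \<in> ?A" for a b
    proof -
      from that obtain f g f' g' where ab: "a = ?a f g" "b = ?a f' g'" by blast
      show ?thesis unfolding ab comp by (rule mem)
    qed
    show "(\<lambda>x. a x + b x) \<in> ?A" if "a \<in> ?A" "b \<in> ?A" for a b
    proof -
      from that obtain f g f' g' where ab: "a = ?a f g" "b = ?a f' g'" by blast
      have "(\<lambda>x. a x + b x) = ?a (f + f') (g + g')"
        unfolding ab by (simp add: poly_map_add[OF T] algebra_simps)
      then show ?thesis by (simp only: mem)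
    qed
    show "(\<lambda>x. c *s a x) \<in> ?A" if "a \<in> ?A" for a c
    proof -
      from that obtain f g where a: "a = ?a f g" by blast
      have "(\<lambda>x. c *s a x) = ?a (smult c f) (smult c g)"
        unfolding a by (simp add: poly_map_smult[OF T] scale_right_distrib)
      then show ?thesis by (simp only: mem)
    qed
    show "(\<lambda>x. x) \<in> ?A" using mem[of 1 0] by (simp add: T)
    show "X \<in> ?A" using mem[of 0 1] by (simp add: T)
    show "Y \<in> ?A" using mem[of 0 "[:0, 1:]"] by (simp add: T TX endo.linear_0[OF T])
    show "a x = 0" if "a \<in> ?A" and a0: "\<And>b. b \<in> ?A \<Longrightarrow> form q (b (a v)) = 0" for a x
    proof -
      from that(1) obtain f g where a: "a = ?a f g" by blast
      \<comment> \<open>Testing with \<open>b\<close> a polynomial times \<open>X\<close> isolates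
        \<open>f\<close>, since \<open>X\<close> has square zero; plain polynomials then isolate
        \<open>g\<close>.\<close>
      have f0: "?e f x = 0" for x
      proof (rule key)
        fix h
        from a0[OF mem[of 0 h]] show "form q (?e h (?e f (X v))) = 0"
          by (simp add: a endo.linear_add[OF X] eX XX endo.linear_0[OF e_lin])
      qed
      have g0: "?e g x = 0" for x
      proof (rule key)
        fix h
        from a0[OF mem[of h 0]] show "form q (?e h (?e g (X v))) = 0"
          by (simp add: a f0)
      qed
      show ?thesis by (simp add: a f0 g0)
    qed
  qed
qed

section \<open>Modules with XY nonzero, and one-dimensional summands\<close>

text \<open>The algebra spanned by 1, \<open>X\<close>, \<open>Y\<close> and \<open>XY\<close> is
  the image of the group algebra. Its product \<open>XY\<close> spans the socle, so a functional
  that is nonzero on \<open>X (Y v)\<close> is nondegenerate.\<close>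

lemma iso_dual_product_nonzero:
  assumes X: "lin X" and Y: "lin Y" and indec: "indec X Y"
    and XX: "\<And>x. X (X x) = 0" and YY: "\<And>x. Y (Y x) = 0" and comm: "\<And>x. Y (X x) = X (Y x)"
    and v: "X (Y v) \<noteq> 0"
  shows "iso_dual X Y"
proof -
  obtain q where q: "form q (X (Y v)) \<noteq> 0" using form_separates v by blast
  let ?a = "\<lambda>\<alpha> \<beta> \<gamma> \<delta> x. \<alpha> *s x + \<beta> *s X x + \<gamma> *s Y x + \<delta> *s X (Y x)"
  let ?A = "{?a \<alpha> \<beta> \<gamma> \<delta> | \<alpha> \<beta> \<gamma> \<delta>. True}"
  note XY_simps = endo.linear_add[OF X] endo.linear_scale[OF X] endo.linear_0[OF X]
    endo.linear_add[OF Y] endo.linear_scale[OF Y] endo.linear_0[OF Y] XX YY comm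
  have comp: "?a \<alpha> \<beta> \<gamma> \<delta> (?a \<alpha>' \<beta>' \<gamma>' \<delta>' x) =
    ?a (\<alpha> * \<alpha>') (\<alpha> * \<beta>' + \<beta> * \<alpha>') (\<alpha> * \<gamma>' + \<gamma> * \<alpha>') (\<alpha> * \<delta>' + \<beta> * \<gamma>' + \<gamma> * \<beta>' + \<delta> * \<alpha>') x"
    for \<alpha> \<beta> \<gamma> \<delta> \<alpha>' \<beta>' \<gamma>' \<delta>' x
    by (simp add: XY_simps scale_right_distrib scale_left_distrib)
  have mem: "?a \<alpha> \<beta> \<gamma> \<delta> \<in> ?A" for \<alpha> \<beta> \<gamma> \<delta> by blast
  show ?thesis
  proof (rule iso_dual_cyclic[OF X Y indec, of ?A q v])
    show "lin a" if "a \<in> ?A" for a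
      using that by (auto simp: lin_iff XY_simps algebra_simps)
    show "a (b x) = b (a x)" if ab: "a \<in> ?A" "b \<in> ?A" for a b x
    proof -
      from ab obtain \<alpha> \<beta> \<gamma> \<delta> \<alpha>' \<beta>' \<gamma>' \<delta>' where ab: "a = ?a \<alpha> \<beta> \<gamma> \<delta>" "b = ?a \<alpha>' \<beta>' \<gamma>' \<delta>'" by blast
      show ?thesis unfolding ab comp by (simp add: algebra_simps)
    qed
    show "(\<lambda>x. a (b x)) \<in> ?A" if ab: "a \<in> ?A" "b \<in> ?A" for a b
    proof -
      from ab obtain \<alpha> \<beta> \<gamma> \<delta> \<alpha>' \<beta>' \<gamma>' \<delta>' where ab: "a = ?a \<alpha> \<beta> \<gamma> \<delta>" "b = ?a \<alpha>' \<beta>' \<gamma>' \<delta>'" by blast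
      show ?thesis unfolding ab comp by (rule mem)
    qed
    show "(\<lambda>x. a x + b x) \<in> ?A" if ab: "a \<in> ?A" "b \<in> ?A" for a b
    proof -
      from ab obtain \<alpha> \<beta> \<gamma> \<delta> \<alpha>' \<beta>' \<gamma>' \<delta>' where ab: "a = ?a \<alpha> \<beta> \<gamma> \<delta>" "b = ?a \<alpha>' \<beta>' \<gamma>' \<delta>'" by blast
      have "(\<lambda>x. a x + b x) = ?a (\<alpha> + \<alpha>') (\<beta> + \<beta>') (\<gamma> + \<gamma>') (\<delta> + \<delta>')"
        unfolding ab by (simp add: scale_left_distrib algebra_simps)
      then show ?thesis using mem by simp
    qed
    show "(\<lambda>x. c *s a x) \<in> ?A" if "a \<in> ?A" for a c
    proof -
      from that obtain \<alpha> \<beta> \<gamma> \<delta> where a: "a = ?a \<alpha> \<beta> \<gamma> \<delta>" by blast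
      have "(\<lambda>x. c *s a x) = ?a (c * \<alpha>) (c * \<beta>) (c * \<gamma>) (c * \<delta>)"
        unfolding a by (simp add: scale_right_distrib)
      then show ?thesis using mem by simp
    qed
    show "(\<lambda>x. x) \<in> ?A" using mem[of 1 0 0 0] by simp
    show "X \<in> ?A" using mem[of 0 1 0 0] by simp
    show "Y \<in> ?A" using mem[of 0 0 1 0] by simp
    show "a x = 0" if "a \<in> ?A" and a0: "\<And>b. b \<in> ?A \<Longrightarrow> form q (b (a v)) = 0" for a x
    proof -
      from that(1) obtain \<alpha> \<beta> \<gamma> \<delta> where a: "a = ?a \<alpha> \<beta> \<gamma> \<delta>" by blast
      \<comment> \<open>Multiplying by \<open>XY\<close>, \<open>Y\<close>, \<open>X\<close> and 1
        in turn moves one surviving coefficient after another onto \<open>X (Y v)\<close>.\<close>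
      have 1: "\<alpha> = 0" using a0[OF mem[of 0 0 0 1]] q by (simp add: a XY_simps form_simps)
      have 2: "\<beta> = 0" using a0[OF mem[of 0 0 1 0]] q by (simp add: a 1 XY_simps form_simps)
      have 3: "\<gamma> = 0" using a0[OF mem[of 0 1 0 0]] q by (simp add: a 1 2 XY_simps form_simps)
      have 4: "\<delta> = 0" using a0[OF mem[of 1 0 0 0]] q by (simp add: a 1 2 3 XY_simps form_simps)
      show ?thesis by (simp add: a 1 2 3 4)
    qed
  qed
qed

text \<open>A functional \<open>q\<close> that vanishes on the radical but not on \<open>x\<close>
  is killed by both adjoints. Hence the lines through \<open>x\<close> and \<open>q\<close> pair
  perfectly, and the line through \<open>x\<close> splits off.\<close>

lemma socle_outside_radical:
  assumes X: "lin X" and Y: "lin Y" and indec: "indec X Y"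
    and x: "X x = 0" "Y x = 0" and xR: "x \<notin> {X a + Y b |a b. True}"
  shows "dim UNIV = 1"
proof -
  let ?R = "{X a + Y b |a b. True}"
  have "?R = {a + b |a b. a \<in> range X \<and> b \<in> range Y}" by blast
  then have "subspace ?R"
    using subspace_sums[OF endo.linear_subspace_image[OF X subspace_UNIV]
        endo.linear_subspace_image[OF Y subspace_UNIV]] by simp
  then obtain q where q: "q \<in> perp ?R" "form q x \<noteq> 0"
    using xR by (rule perp_separates)
  have "form q (X a) = 0" "form q (Y a) = 0" for a
    using perpD[OF q(1), of "X a"] perpD[OF q(1), of "Y a"] endo.linear_0[OF X] endo.linear_0[OF Y]
    by (metis (mono_tags, lifting) add_0 add_0_right mem_Collect_eq)+
  then have qX: "adj X q = 0" "adj Y q = 0"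
    by (auto intro!: form_nondegenerate simp: form_adj X Y)
  have inv_span: "invariant F G (span {z})" if "lin F" "lin G" "F z = 0" "G z = 0" for F G z
    unfolding invariant_def using that
    by (intro conjI subspace_span lin_image_span) (simp_all add: span_zero)
  have "span {x} = UNIV"
  proof (rule pairing_splits[OF X Y indec])
    show "invariant X Y (span {x})"
      by (intro inv_span X Y x)
    show "invariant (adj X) (adj Y) (span {q})"
      by (intro inv_span lin_adj qX)
    show "span {x} \<inter> perp (span {q}) \<subseteq> {0}" "span {q} \<inter> perp (span {x}) \<subseteq> {0}"
      using q(2) by (auto simp: span_singleton perp_def form_simps form_commute)
    show "\<not> span {x} \<subseteq> {0}" using q(2) span_base[of x "{x}"] by auto
  qed
  moreover have "x \<noteq> 0" using q(2) by auto
  ultimately show ?thesis by (metis dim_singleton dim_span)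
qed

section \<open>Kronecker modules\<close>

lemma span_two_families:
  assumes "finite I" "finite J" "x \<in> span (u ` I \<union> w ` J)"
  obtains a b where "x = (\<Sum>i\<in>I. a i *s u i) + (\<Sum>j\<in>J. b j *s w j)"
proof -
  from assms(3) obtain y z where yz: "y \<in> span (u ` I)" "z \<in> span (w ` J)" "x = y + z"
    unfolding span_Un by blast
  obtain a where "y = (\<Sum>i\<in>I. a i *s u i)" using assms(1) yz(1) by (rule span_family)
  moreover obtain b where "z = (\<Sum>j\<in>J. b j *s w j)" using assms(2) yz(2) by (rule span_family)
  ultimately show ?thesis using yz(3) that by blast
qed

lemma invariant_span:
  assumes "lin X" "lin Y" "\<And>s. s \<in> S \<Longrightarrow> X s \<in> span S" "\<And>s. s \<in> S \<Longrightarrow> Y s \<in> span S"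
  shows "invariant X Y (span S)"
  unfolding invariant_def using assms by (intro conjI subspace_span lin_image_span)

lemma adj_comp_zero: "lin F \<Longrightarrow> lin G \<Longrightarrow> (\<And>x. G (F x) = 0) \<Longrightarrow> adj F (adj G q) = 0"
  by (rule form_eqI) (simp add: form_adj)

lemma adj_eq_zero_iff: "lin F \<Longrightarrow> adj F q = 0 \<longleftrightarrow> q \<in> perp (range F)"
  by (auto simp: perp_def form_adj[symmetric] intro: form_nondegenerate)

section \<open>Chains that cannot be continued\<close>

text \<open>The two chain relations move one index step from \<open>q\<close> to \<open>x\<close>,
  so the value depends on \<open>i + j\<close> only. Below \<open>k\<close> the index of
  \<open>q\<close> can be brought to 0, and one further step produces
  \<open>adj Y (q 0) = 0\<close>.\<close>

lemma hankel_pairing: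
  assumes X: "lin X" and Y: "lin Y"
    and x: "\<And>i. i < k \<Longrightarrow> Y (x (Suc i)) = X (x i)"
    and q0: "adj Y (q 0) = 0" and q: "\<And>i. i < k \<Longrightarrow> adj Y (q (Suc i)) = adj X (q i)"
  shows "i + j < k \<Longrightarrow> form (q i) (X (x j)) = 0"
    and "i + j = k \<Longrightarrow> form (q i) (X (x j)) = form (q 0) (X (x k))"
proof -
  have step: "form (q i) (X (x j)) = form (adj Y (q i)) (x (Suc j))" if "j < k" for i j
    by (simp add: form_adj Y x that)
  have shift: "form (q (Suc i)) (X (x j)) = form (q i) (X (x (Suc j)))" if "Suc i + j \<le> k" for i j
    using that by (simp add: step q form_adj X)
  show "i + j < k \<Longrightarrow> form (q i) (X (x j)) = 0"
  proof (induction i arbitrary: j)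
    case 0
    then show ?case by (simp add: step q0)
  next
    case (Suc i)
    then show ?case by (simp add: shift)
  qed
  show "i + j = k \<Longrightarrow> form (q i) (X (x j)) = form (q 0) (X (x k))"
    by (induction i arbitrary: j) (simp_all add: shift)
qed

text \<open>Applying \<open>X\<close> removes the second sum, so the values at \<open>X m\<close>
  force all \<open>a j\<close> to vanish; the values at \<open>m\<close> then force all
  \<open>b j\<close> to vanish. Both systems are antitriangular.\<close>

lemma hankel_nondegenerate:
  fixes k :: nat
  assumes X: "lin X" and XX: "\<And>x. X (X x) = 0"
    and low: "\<And>i j. i + j < k \<Longrightarrow> form (q i) (X (x j)) = 0"
    and diag: "\<And>i j. i + j = k \<Longrightarrow> form (q i) (X (x j)) \<noteq> 0"
    and m: "m = (\<Sum>j\<le>k. a j *s x j) + (\<Sum>j\<le>k. b j *s X (x j))"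
    and qX: "\<And>i. i \<le> k \<Longrightarrow> form (q i) (X m) = 0"
  shows "m = X (\<Sum>j\<le>k. b j *s x j)"
    and "(\<And>i. i \<le> k \<Longrightarrow> form (q i) m = 0) \<Longrightarrow> m = 0"
proof -
  have Xm: "X m = (\<Sum>j\<le>k. a j *s X (x j))"
    by (simp add: m endo.linear_add[OF X] endo.linear_sum[OF X] endo.linear_scale[OF X] XX)
  have a: "a j = 0" if "j \<le> k" for j
  proof (rule antitriangular_system_zero[of k "\<lambda>i j. form (q i) (X (x j))", OF low diag _ that])
    show "(\<Sum>j\<le>k. a j * form (q i) (X (x j))) = 0" if "i \<le> k" for i
      using qX[OF that] by (simp add: Xm form_simps)
  qed
  then have m': "m = (\<Sum>j\<le>k. b j *s X (x j))" by (simp add: m)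
  then show "m = X (\<Sum>j\<le>k. b j *s x j)"
    by (simp add: endo.linear_sum[OF X] endo.linear_scale[OF X])
  assume q: "\<And>i. i \<le> k \<Longrightarrow> form (q i) m = 0"
  have "b j = 0" if "j \<le> k" for j
  proof (rule antitriangular_system_zero[of k "\<lambda>i j. form (q i) (X (x j))", OF low diag _ that])
    show "(\<Sum>j\<le>k. b j * form (q i) (X (x j))) = 0" if "i \<le> k" for i
      using q[OF that] by (simp add: m' form_simps)
  qed
  then show "m = 0" by (simp add: m')
qed

lemma invariant_chain:
  assumes X: "lin X" and Y: "lin Y" and XX: "\<And>x. X (X x) = 0" and YX: "\<And>x. Y (X x) = 0"
    and x0: "Y (x 0) = 0" and x: "\<And>i. i < k \<Longrightarrow> Y (x (Suc i)) = X (x i)"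
  shows "invariant X Y (span (x ` {..k} \<union> (\<lambda>j. X (x j)) ` {..k}))"
proof (rule invariant_span[OF X Y])
  let ?S = "x ` {..k} \<union> (\<lambda>j. X (x j)) ` {..k}"
  have mem: "X (x j) \<in> span ?S" if "j \<le> k" for j using that by (intro span_base) auto
  fix s assume s: "s \<in> ?S"
  show "X s \<in> span ?S" using s mem by (auto simp: XX span_zero)
  have "Y (x j) \<in> span ?S" if "j \<le> k" for j
    using that by (cases j) (simp_all add: x0 x mem span_zero)
  then show "Y s \<in> span ?S" using s by (auto simp: YX span_zero)
qed

text \<open>A chain and a cochain of the same length, each taken with its images under
  \<open>X\<close> or \<open>adj X\<close>, pair perfectly by the Hankel pattern. So the chain
  generates the module, and there ker X = im X can be read off.\<close>

lemma exact_of_chains: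
  assumes X: "lin X" and Y: "lin Y" and indec: "indec X Y"
    and XX: "\<And>x. X (X x) = 0" and XY: "\<And>x. X (Y x) = 0" and YX: "\<And>x. Y (X x) = 0"
    and x0: "Y (x 0) = 0" and x: "\<And>i. i < k \<Longrightarrow> Y (x (Suc i)) = X (x i)"
    and q0: "adj Y (q 0) = 0" and q: "\<And>i. i < k \<Longrightarrow> adj Y (q (Suc i)) = adj X (q i)"
    and nz: "form (q 0) (X (x k)) \<noteq> 0"
    and m: "X m = 0"
  shows "m \<in> range X"
proof -
  let ?U = "span (x ` {..k} \<union> (\<lambda>j. X (x j)) ` {..k})"
  let ?P = "span (q ` {..k} \<union> (\<lambda>j. adj X (q j)) ` {..k})"
  have low: "form (q i) (X (x j)) = 0" if "i + j < k" for i j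
    by (rule hankel_pairing(1)[where x = x and q = q and k = k, OF X Y x q0 q that])
  have "form (q i) (X (x j)) = form (q 0) (X (x k))" if "i + j = k" for i j
    by (rule hankel_pairing(2)[where x = x and q = q and k = k, OF X Y x q0 q that])
  then have diag: "form (q i) (X (x j)) \<noteq> 0" if "i + j = k" for i j using that nz by metis
  have "?U = UNIV"
  proof (rule pairing_splits[OF X Y indec])
    show "invariant X Y ?U" by (rule invariant_chain[where x = x and k = k, OF X Y XX YX x0 x])
    show "invariant (adj X) (adj Y) ?P"
      by (rule invariant_chain[where x = q and k = k, OF lin_adj lin_adj _ _ q0 q]) (simp_all add: adj_comp_zero X Y XX XY)
    show "?U \<inter> perp ?P \<subseteq> {0}"
    proof clarify
      fix u assume u: "u \<in> ?U" and perp: "u \<in> perp ?P"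
      obtain a b where ab: "u = (\<Sum>j\<le>k. a j *s x j) + (\<Sum>j\<le>k. b j *s X (x j))"
        using span_two_families[OF finite_atMost finite_atMost u] .
      show "u = 0"
      proof (rule hankel_nondegenerate(2)[where x = x and q = q and k = k, OF X XX low diag ab])
        fix i assume i: "i \<le> k"
        then have "adj X (q i) \<in> ?P" "q i \<in> ?P" by (auto intro: span_base)
        then have "form u (adj X (q i)) = 0" "form u (q i) = 0" using perpD[OF perp] by auto
        then show "form (q i) (X u) = 0" "form (q i) u = 0"
          by (simp_all add: form_adj2 X form_commute)
      qed
    qed
    show "?P \<inter> perp ?U \<subseteq> {0}"
    proof clarify
      fix p assume p: "p \<in> ?P" and perp: "p \<in> perp ?U"
      obtain a b where ab: "p = (\<Sum>j\<le>k. a j *s q j) + (\<Sum>j\<le>k. b j *s adj X (q j))"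
        using span_two_families[OF finite_atMost finite_atMost p] .
      show "p = 0"
      \<comment> \<open>The same argument with chain and cochain exchanged and \<open>adj X\<close>
        in place of \<open>X\<close>.\<close>
      proof (rule hankel_nondegenerate(2)[where x = q and q = x and k = k, OF lin_adj _ _ _ ab])
        show "adj X (adj X y) = 0" for y by (simp add: adj_comp_zero X XX)
        show "form (x i) (adj X (q j)) = 0" if "i + j < k" for i j
          using low[of j i] that by (simp add: form_adj2 X form_commute add.commute)
        show "form (x i) (adj X (q j)) \<noteq> 0" if "i + j = k" for i j
          using diag[of j i] that by (simp add: form_adj2 X form_commute add.commute)
        fix i assume i: "i \<le> k"
        then have "X (x i) \<in> ?U" "x i \<in> ?U" by (auto intro: span_base)
        then have "form p (X (x i)) = 0" "form p (x i) = 0" using perpD[OF perp] by auto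
        then show "form (x i) (adj X p) = 0" "form (x i) p = 0"
          by (simp_all add: form_adj2 X form_commute)
      qed
    qed
    show "\<not> ?U \<subseteq> {0}"
    proof
      assume "?U \<subseteq> {0}"
      moreover have "X (x k) \<in> ?U" by (auto intro: span_base)
      ultimately show False using nz by auto
    qed
  qed
  then have "m \<in> ?U" by simp
  then obtain a b where "m = (\<Sum>j\<le>k. a j *s x j) + (\<Sum>j\<le>k. b j *s X (x j))"
    by (rule span_two_families[OF finite_atMost finite_atMost])
  from hankel_nondegenerate(1)[where x = x and q = q and k = k, OF X XX low diag this] m show ?thesis by simp
qed

section \<open>Closed chains and odd dimension\<close>

text \<open>The chain and its images under \<open>X\<close> generate a Kronecker module of dimension
  \<open>2 * e + 1\<close>. Its dual generators are \<open>q\<close>, a chain with the roles of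
  \<open>X\<close> and \<open>Y\<close> exchanged, and the functionals \<open>w\<close>.\<close>

lemma odd_of_closed_chain:
  assumes X: "lin X" and Y: "lin Y" and indec: "indec X Y"
    and XX: "\<And>x. X (X x) = 0" and YY: "\<And>x. Y (Y x) = 0"
    and XY: "\<And>x. X (Y x) = 0" and YX: "\<And>x. Y (X x) = 0"
    and x0: "Y (x 0) = 0" and x: "\<And>i. i < e \<Longrightarrow> Y (x (Suc i)) = X (x i)" and xe: "X (x e) = 0"
    and e: "0 < e" and q: "\<And>i. Suc i < e \<Longrightarrow> adj X (q (Suc i)) = adj Y (q i)"
    and nz: "form (q 0) (X (x 0)) \<noteq> 0"
  shows "odd (dim UNIV)"
proof -
  define c where "c = form (q 0) (X (x 0))"
  have c: "c \<noteq> 0" using nz by (simp add: c_def)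
  have shift: "form (q (Suc i)) (X (x (Suc j))) = form (q i) (X (x j))" if "Suc i < e" "j < e" for i j
  proof -
    have "form (q (Suc i)) (X (x (Suc j))) = form (adj Y (q i)) (x (Suc j))"
      by (simp add: form_adj[OF X, symmetric] q that)
    then show ?thesis by (simp add: form_adj Y x that)
  qed
  have shifts: "form (q (i + d)) (X (x (j + d))) = form (q i) (X (x j))" if "i + d < e" "j + d \<le> e" for i j d
    using that by (induction d) (simp_all add: shift)
  have first: "form (q (Suc i)) (X (x 0)) = 0" if "Suc i < e" for i
  proof -
    have "form (q (Suc i)) (X (x 0)) = form (adj Y (q i)) (x 0)"
      by (simp add: form_adj[OF X, symmetric] q that)
    then show ?thesis by (simp add: form_adj Y x0)
  qed
  \<comment> \<open>The matrix is constant along diagonals. Above the main one a shift reaches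
    \<open>X (x e) = 0\<close>; below it a shift back reaches \<open>Y (x 0) = 0\<close>.\<close>
  have h: "form (q i) (X (x j)) = (if i = j then c else 0)" if ij: "i < e" "j \<le> e" for i j
  proof (cases i j rule: linorder_cases)
    case less
    then show ?thesis using shifts[of i "e - j" j] ij by (simp add: xe)
  next
    case equal
    then show ?thesis using shifts[of 0 i 0] ij by (simp add: c_def)
  next
    case greater
    then obtain d where "i = Suc d + j" by (metis add.commute less_imp_Suc_add add_Suc_right add_Suc)
    then show ?thesis using shifts[of "Suc d" j 0] first[of d] ij by simp
  qed
  \<comment> \<open>The functionals dual to \<open>x 0\<close>, ..., \<open>x e\<close>. The cochain
    has only \<open>e\<close> members, so the last functional comes from \<open>adj Y\<close>
    instead of \<open>adj X\<close>.\<close>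
  define w where "w j = (if j < e then adj X (q j) else adj Y (q (e - 1)))" for j
  have wY: "adj Y (q i) = w (Suc i)" if "i < e" for i
  proof (cases "Suc i < e")
    case True
    then show ?thesis by (simp add: w_def q)
  next
    case False
    then have "e = Suc i" using that by simp
    then show ?thesis by (simp add: w_def)
  qed
  have wx: "form (w j) (x l) = (if j = l then c else 0)" if jl: "j \<le> e" "l \<le> e" for j l
  proof (cases "j < e")
    case True
    then show ?thesis using h jl by (simp add: w_def form_adj X)
  next
    case False
    then have j: "j = e" using jl by simp
    then have "form (w j) (x l) = form (q (e - 1)) (Y (x l))" by (simp add: w_def form_adj Y)
    then show ?thesis using h[of "e - 1"] j jl e by (cases l) (auto simp: x0 x)
  qed
  have wX: "form (w j) (X y) = 0" for j y
    by (simp add: w_def form_adj X Y XX YX)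
  let ?V = "(\<lambda>j. X (x j)) ` {..<e}"
  let ?U = "span (x ` {..e} \<union> ?V)" and ?P = "span (q ` {..<e} \<union> w ` {..e})"
  have U: "?U = UNIV"
  proof (rule pairing_splits[OF X Y indec])
    show "invariant X Y ?U"
    proof (rule invariant_span[OF X Y])
      have mem: "X (x j) \<in> ?U" if "j < e" for j using that by (intro span_base) auto
      have "X (x j) \<in> ?U" if "j \<le> e" for j
        using mem[of j] that by (cases "j = e") (simp_all add: xe span_zero)
      moreover have "Y (x j) \<in> ?U" if "j \<le> e" for j
        using that by (cases j) (simp_all add: x0 x mem span_zero)
      ultimately show "X s \<in> ?U" "Y s \<in> ?U" if "s \<in> x ` {..e} \<union> ?V" for s
        using that by (auto simp: XX YX span_zero)
    qed
    show "invariant (adj X) (adj Y) ?P"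
    proof (rule invariant_span[OF lin_adj lin_adj])
      have "adj X (q i) \<in> ?P" "adj Y (q i) \<in> ?P" if "i < e" for i
      proof -
        have "adj X (q i) = w i" using that by (simp add: w_def)
        then show "adj X (q i) \<in> ?P" using that by (auto intro: span_base)
        show "adj Y (q i) \<in> ?P" unfolding wY[OF that] using that by (auto intro: span_base)
      qed
      moreover have "adj X (w j) = 0" "adj Y (w j) = 0" for j
        by (simp_all add: w_def adj_comp_zero X Y XX YY XY YX)
      ultimately show "adj X s \<in> ?P" "adj Y s \<in> ?P" if "s \<in> q ` {..<e} \<union> w ` {..e}" for s
        using that by (auto simp: span_zero)
    qed
    show "?U \<inter> perp ?P \<subseteq> {0}"
    proof clarify
      fix u assume u: "u \<in> ?U" and perp: "u \<in> perp ?P"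
      obtain a b where ab: "u = (\<Sum>j\<le>e. a j *s x j) + (\<Sum>j<e. b j *s X (x j))"
        using span_two_families[OF finite_atMost finite_lessThan u] .
      have "a j = 0" if "j \<le> e" for j
      proof -
        have "w j \<in> ?P" using that by (auto intro: span_base)
        then have "form (w j) u = 0" using perpD[OF perp] by (metis form_commute)
        then show ?thesis using c that
          by (simp add: ab form_simps wx wX sum_mult_delta cong: sum.cong_simp)
      qed
      then have u': "u = (\<Sum>j<e. b j *s X (x j))" by (simp add: ab)
      have "b i = 0" if "i < e" for i
      proof -
        have "q i \<in> ?P" using that by (auto intro: span_base)
        then have "form (q i) u = 0" using perpD[OF perp] by (metis form_commute)
        then show ?thesis using c that
          by (simp add: u' form_simps h sum_mult_delta cong: sum.cong_simp)
      qed
      then show "u = 0" by (simp add: u')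
    qed
    show "?P \<inter> perp ?U \<subseteq> {0}"
    proof clarify
      fix p assume p: "p \<in> ?P" and perp: "p \<in> perp ?U"
      obtain a b where ab: "p = (\<Sum>j<e. a j *s q j) + (\<Sum>j\<le>e. b j *s w j)"
        using span_two_families[OF finite_lessThan finite_atMost p] .
      have "a j = 0" if "j < e" for j
      proof -
        have "X (x j) \<in> ?U" using that by (auto intro: span_base)
        then have "form p (X (x j)) = 0" using perpD[OF perp] by blast
        then show ?thesis using c that
          by (simp add: ab form_simps h wX sum_mult_delta cong: sum.cong_simp)
      qed
      then have p': "p = (\<Sum>j\<le>e. b j *s w j)" by (simp add: ab)
      have "b i = 0" if "i \<le> e" for i
      proof -
        have "x i \<in> ?U" using that by (auto intro: span_base)
        then have "form p (x i) = 0" using perpD[OF perp] by blast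
        then show ?thesis using c that
          by (simp add: p' form_simps wx sum_mult_delta cong: sum.cong_simp)
      qed
      then show "p = 0" by (simp add: p')
    qed
    show "\<not> ?U \<subseteq> {0}"
    proof
      assume "?U \<subseteq> {0}"
      moreover have "X (x 0) \<in> ?U" using e by (auto intro: span_base)
      ultimately show False using nz by auto
    qed
  qed
  have decomp: "\<exists>a b. y = (\<Sum>j\<le>e. a j *s x j) + (\<Sum>j<e. b j *s X (x j))" for y
    using span_two_families[OF finite_atMost finite_lessThan, of y x e "\<lambda>j. X (x j)" e] U by blast
  have Xy: "X ((\<Sum>j\<le>e. a j *s x j) + (\<Sum>j<e. b j *s X (x j))) = (\<Sum>j<e. a j *s X (x j))" for a b
    by (simp add: endo.linear_add[OF X] endo.linear_sum[OF X] endo.linear_scale[OF X] XX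
        lessThan_Suc_atMost[symmetric] xe)
  have V_sum: "(\<Sum>j<e. b j *s X (x j)) \<in> span ?V" for b
    by (intro span_sum span_scale span_base) auto
  have "range X = span ?V"
  proof
    show "range X \<subseteq> span ?V"
    proof clarify
      fix y
      obtain a b where "y = (\<Sum>j\<le>e. a j *s x j) + (\<Sum>j<e. b j *s X (x j))" using decomp by blast
      then show "X y \<in> span ?V" by (simp only: Xy V_sum)
    qed
    show "span ?V \<subseteq> range X"
      by (intro span_minimal endo.linear_subspace_image X subspace_UNIV) auto
  qed
  moreover have "{y. X y = 0} = span (insert (x e) ?V)"
  proof
    show "{y. X y = 0} \<subseteq> span (insert (x e) ?V)"
    proof clarify
      fix y assume y: "X y = 0"
      obtain a b where ab: "y = (\<Sum>j\<le>e. a j *s x j) + (\<Sum>j<e. b j *s X (x j))" using decomp by blast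
      have X0: "(\<Sum>j<e. a j *s X (x j)) = 0" using y unfolding ab Xy .
      have "a i = 0" if "i < e" for i
        using arg_cong[OF X0, of "form (q i)"] c that
        by (simp add: form_simps h sum_mult_delta cong: sum.cong_simp)
      then have "y = a e *s x e + (\<Sum>j<e. b j *s X (x j))"
        by (simp add: ab lessThan_Suc_atMost[symmetric])
      moreover have "a e *s x e \<in> span (insert (x e) ?V)" by (intro span_scale span_base) simp
      moreover have "(\<Sum>j<e. b j *s X (x j)) \<in> span (insert (x e) ?V)"
        using V_sum span_mono[of ?V "insert (x e) ?V"] by blast
      ultimately show "y \<in> span (insert (x e) ?V)" by (simp add: span_add)
    qed
    show "span (insert (x e) ?V) \<subseteq> {y. X y = 0}"
      by (intro span_minimal endo.linear_subspace_kernel X) (auto simp: xe XX)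
  qed
  moreover have "x e \<notin> span ?V"
  proof
    assume "x e \<in> span ?V"
    moreover have "subspace {y. form (w e) y = 0}" by (auto simp: subspace_def form_simps)
    then have "span ?V \<subseteq> {y. form (w e) y = 0}"
      by (intro span_minimal) (auto simp: wX)
    ultimately show False using wx[of e e] c by auto
  qed
  \<comment> \<open>The kernel of \<open>X\<close> exceeds its image by the single vector
    \<open>x e\<close>, so rank-nullity gives odd dimension without computing
    \<open>dim ?V\<close>.\<close>
  ultimately have "dim (range X) = dim ?V" "dim {y. X y = 0} = dim ?V + 1"
    by (simp_all add: dim_insert)
  then have "dim UNIV = dim ?V + (dim ?V + 1)"
    using dim_image_kernel[OF X subspace_UNIV] by simp
  then show ?thesis by presburger
qed

text \<open>The last vectors \<open>x\<^sub>n\<close> of the chains \<open>Y x\<^sub>0 = 0\<close>, \<open>Y x\<^sub>i\<^sub>+\<^sub>1 = X x\<^sub>i\<close>.\<close>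

fun zigzag :: "('v \<Rightarrow> 'v) \<Rightarrow> ('v \<Rightarrow> 'v) \<Rightarrow> nat \<Rightarrow> 'v set" where
  "zigzag X Y 0 = {x. Y x = 0}"
| "zigzag X Y (Suc n) = {x. Y x \<in> X ` zigzag X Y n}"

section \<open>Zigzag subspaces and cochains\<close>

lemma subspace_zigzag: "lin X \<Longrightarrow> lin Y \<Longrightarrow> subspace (zigzag X Y n)"
  by (induction n) (simp_all add: endo.linear_subspace_kernel endo.linear_subspace_linear_preimage
      endo.linear_subspace_image)

lemma zigzag_Suc:
  assumes "lin X" "lin Y"
  shows "zigzag X Y n \<subseteq> zigzag X Y (Suc n)"
proof (induction n)
  case 0
  have "0 \<in> X ` {x. Y x = 0}"
    using endo.linear_0[OF assms(1)] endo.linear_0[OF assms(2)] by (intro image_eqI[of _ _ 0]) simp_all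
  then show ?case by auto
next
  case (Suc n)
  then show ?case by (simp only: zigzag.simps) blast
qed

lemma zigzag_chain:
  "y \<in> zigzag X Y n \<Longrightarrow> \<exists>x. x n = y \<and> Y (x 0) = 0 \<and> (\<forall>i<n. Y (x (Suc i)) = X (x i))"
proof (induction n arbitrary: y)
  case 0
  then show ?case by (intro exI[of _ "\<lambda>_. y"]) simp
next
  case (Suc n)
  then obtain d where d: "d \<in> zigzag X Y n" "Y y = X d" by auto
  from Suc.IH[OF d(1)] obtain x where x: "x n = d" "Y (x 0) = 0" "\<forall>i<n. Y (x (Suc i)) = X (x i)" by blast
  then show ?case using d(2)
    by (intro exI[of _ "x(Suc n := y)"]) (auto simp: less_Suc_eq)
qed

text \<open>Each new member solves an equation for \<open>adj Y\<close>. Solvability only asks the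
  previous member to vanish on a zigzag image, and the solution can be chosen to vanish on the next
  smaller one. For \<open>n = 0\<close> there is no condition.\<close>

lemma cochain_exists:
  assumes X: "lin X" and Y: "lin Y"
  shows "(\<And>j. n = Suc j \<Longrightarrow> p \<in> perp (X ` zigzag X Y j)) \<Longrightarrow>
    \<exists>q. q 0 = p \<and> (\<forall>i<n. adj Y (q (Suc i)) = adj X (q i))"
proof (induction n arbitrary: p)
  case 0
  then show ?case by (intro exI[of _ "\<lambda>_. p"]) simp
next
  case (Suc n)
  \<comment> \<open>Chosen so that its preimage under \<open>Y\<close> is
    \<open>zigzag X Y n\<close>.\<close>
  let ?S = "case n of 0 \<Rightarrow> {0} | Suc j \<Rightarrow> X ` zigzag X Y j"
  have "subspace ?S"
    by (cases n) (simp_all add: endo.linear_subspace_image X subspace_zigzag Y)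
  moreover have "form (adj X p) m = 0" if "Y m \<in> ?S" for m
  proof -
    have "m \<in> zigzag X Y n" using that by (cases n) auto
    then show ?thesis using perpD[OF Suc.prems[OF refl], of "X m"] by (simp add: form_adj X)
  qed
  ultimately obtain p' where p': "p' \<in> perp ?S" "adj Y p' = adj X p"
    using adj_solvable[OF Y] by blast
  have "\<exists>q. q 0 = p' \<and> (\<forall>i<n. adj Y (q (Suc i)) = adj X (q i))"
    by (rule Suc.IH) (use p'(1) in simp)
  then obtain q where q: "q 0 = p'" "\<forall>i<n. adj Y (q (Suc i)) = adj X (q i)" by blast
  show ?case
  proof (intro exI[of _ "case_nat p q"] conjI allI impI)
    fix i assume "i < Suc n"
    then show "adj Y (case_nat p q (Suc i)) = adj X (case_nat p q i)"
      using q p'(2) by (cases i) auto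
  qed simp
qed

text \<open>Walking along the reversed zigzag lengthens the forward one by a step each time. The
  walk ends at the last vector not killed by \<open>Y\<close>, and that one is killed by
  \<open>X\<close>.\<close>

lemma zigzag_reverse:
  assumes "z \<in> zigzag Y X j" "z \<in> zigzag X Y i" "Y z \<noteq> 0"
  shows "\<exists>l\<le>i + j. \<exists>y\<in>zigzag X Y l. X y = 0 \<and> Y y \<noteq> 0"
  using assms
proof (induction j arbitrary: z i)
  case 0
  then show ?case by auto
next
  case (Suc j)
  then obtain z' where z': "z' \<in> zigzag Y X j" "X z = Y z'" by auto
  show ?case
  proof (cases "Y z' = 0")
    case True
    then show ?thesis using Suc.prems z' by (intro exI[of _ i]) auto
  next
    case False
    have "z' \<in> zigzag X Y (Suc i)" using Suc.prems(2) z'(2) by (auto intro!: image_eqI[of _ _ z])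
    from Suc.IH[OF z'(1) this False] show ?thesis by simp
  qed
qed

section \<open>The dichotomy for Kronecker modules\<close>

lemma exact_of_kernel_not_subset:
  assumes X: "lin X" and Y: "lin Y" and indec: "indec X Y" and even: "even (dim UNIV)"
    and XX: "\<And>x. X (X x) = 0" and YY: "\<And>x. Y (Y x) = 0"
    and XY: "\<And>x. X (Y x) = 0" and YX: "\<And>x. Y (X x) = 0"
    and z: "Y z = 0" "X z \<noteq> 0" and m: "X m = 0"
  shows "m \<in> range X"
proof (cases "\<exists>k. \<exists>d\<in>zigzag X Y k. X d \<notin> range Y")
  case True
  then obtain k where "\<exists>d\<in>zigzag X Y k. X d \<notin> range Y"
    and k: "\<And>j. j < k \<Longrightarrow> \<not> (\<exists>d\<in>zigzag X Y j. X d \<notin> range Y)"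
    using exists_least_iff[of "\<lambda>k. \<exists>d\<in>zigzag X Y k. X d \<notin> range Y"] by blast
  then obtain d where d: "d \<in> zigzag X Y k" "X d \<notin> range Y" by blast
  obtain x where x: "x k = d" "Y (x 0) = 0" "\<forall>i<k. Y (x (Suc i)) = X (x i)"
    using zigzag_chain[OF d(1)] by blast
  obtain p where p: "p \<in> perp (range Y)" "form p (X d) \<noteq> 0"
    using endo.linear_subspace_image[OF Y subspace_UNIV] d(2) by (rule perp_separates)
  \<comment> \<open>Minimality of \<open>k\<close> puts the images of all shorter zigzags into
    \<open>range Y\<close>, where \<open>p\<close> vanishes.\<close>
  have "\<exists>q. q 0 = p \<and> (\<forall>i<k. adj Y (q (Suc i)) = adj X (q i))"
  proof (rule cochain_exists[OF X Y])
    fix j assume "k = Suc j"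
    then have "X ` zigzag X Y j \<subseteq> range Y" using k[of j] by blast
    then show "p \<in> perp (X ` zigzag X Y j)" using p(1) unfolding perp_def by blast
  qed
  then obtain q where q: "q 0 = p" "\<forall>i<k. adj Y (q (Suc i)) = adj X (q i)" by blast
  show ?thesis
  proof (rule exact_of_chains[where x = x and q = q and k = k, OF X Y indec XX XY YX x(2) _ _ _ _ m])
    show "adj Y (q 0) = 0" using p(1) q(1) by (simp add: adj_eq_zero_iff Y)
  qed (use x q p in auto)
next
  case False
  let ?D = "zigzag X Y"
  have sD: "subspace (?D n)" for n by (rule subspace_zigzag[OF X Y])
  have "dim (?D n) \<le> dim UNIV" for n by (intro dim_subset subset_UNIV)
  then have "\<exists>N. True \<and> (\<forall>n. True \<longrightarrow> dim (?D n) \<le> dim (?D N))"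
    by (intro ex_has_greatest_nat[of _ 0 _ "Suc (dim UNIV)"]) (simp_all add: less_Suc_eq_le del: dim_UNIV)
  then obtain N where N: "\<And>n. dim (?D n) \<le> dim (?D N)" by blast
  have stable: "?D N = ?D (Suc N)"
    by (rule subspace_dim_equal[OF sD sD zigzag_Suc[OF X Y] N])
  \<comment> \<open>On the stable subspace both operators have the same image, hence kernels of
    equal dimension. As \<open>z\<close> is killed by \<open>Y\<close> but not by \<open>X\<close>,
    some vector is killed by \<open>X\<close> but not by \<open>Y\<close>.\<close>
  have "X ` ?D N = Y ` ?D N"
  proof
    show "Y ` ?D N \<subseteq> X ` ?D N"
    proof clarify
      fix x assume "x \<in> ?D N"
      then have "x \<in> ?D (Suc N)" unfolding stable[symmetric] .
      then show "Y x \<in> X ` ?D N" by simp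
    qed
    show "X ` ?D N \<subseteq> Y ` ?D N"
    proof clarify
      fix d assume d: "d \<in> ?D N"
      then obtain y where y: "X d = Y y" using False by blast
      then have "y \<in> ?D (Suc N)" using d by (auto intro: rev_image_eqI)
      then have "y \<in> ?D N" unfolding stable[symmetric] .
      then show "X d \<in> Y ` ?D N" using y by blast
    qed
  qed
  then have dims: "dim {x \<in> ?D N. X x = 0} = dim {x \<in> ?D N. Y x = 0}"
    using dim_image_kernel[OF X sD[of N]] dim_image_kernel[OF Y sD[of N]] by simp
  have "?D 0 \<subseteq> ?D n" for n by (induction n) (use zigzag_Suc[OF X Y] in blast)+
  then have z_mem: "z \<in> ?D N" using z(1) by auto
  have "\<exists>y\<in>?D N. X y = 0 \<and> Y y \<noteq> 0"
  proof (rule ccontr)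
    assume "\<not> ?thesis"
    then have "{x \<in> ?D N. X x = 0} \<subseteq> {x \<in> ?D N. Y x = 0}" by blast
    moreover have "subspace {x \<in> ?D N. F x = 0}" if "lin F" for F
      using subspace_inter[OF sD[of N] endo.linear_subspace_kernel[OF that]] by (simp add: Int_def)
    ultimately have "{x \<in> ?D N. X x = 0} = {x \<in> ?D N. Y x = 0}"
      using dims X Y by (intro subspace_dim_equal) simp_all
    then show False using z z_mem by blast
  qed
  then have "\<exists>n. \<exists>y\<in>?D n. X y = 0 \<and> Y y \<noteq> 0" by blast
  then obtain e where "\<exists>y\<in>?D e. X y = 0 \<and> Y y \<noteq> 0"
    and least: "\<And>l. l < e \<Longrightarrow> \<not> (\<exists>y\<in>?D l. X y = 0 \<and> Y y \<noteq> 0)"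
    using exists_least_iff[of "\<lambda>n. \<exists>y\<in>?D n. X y = 0 \<and> Y y \<noteq> 0"] by blast
  then obtain y where y: "y \<in> ?D e" "X y = 0" "Y y \<noteq> 0" by blast
  obtain x where x: "x e = y" "Y (x 0) = 0" "\<forall>i<e. Y (x (Suc i)) = X (x i)"
    using zigzag_chain[OF y(1)] by blast
  have "e \<noteq> 0" using y by (intro notI) simp
  then obtain n where n: "e = Suc n" by (cases e) auto
  let ?S = "case n of 0 \<Rightarrow> {0} | Suc j \<Rightarrow> Y ` zigzag Y X j"
  \<comment> \<open>Otherwise the chain without \<open>x 0\<close> would be a shorter one with the
    same end.\<close>
  have Xx0: "X (x 0) \<noteq> 0"
  proof
    assume X0: "X (x 0) = 0"
    have "x (Suc i) \<in> ?D i" if "i < e" for i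
      using that
    proof (induction i)
      case 0
      then show ?case using x(3) X0 by simp
    next
      case (Suc i)
      then have "x (Suc i) \<in> ?D i" "Y (x (Suc (Suc i))) = X (x (Suc i))" using x(3) by auto
      then show ?case by simp
    qed
    from this[of n] have "y \<in> ?D n" using n x(1) by simp
    then show False using least[of n] n y by blast
  qed
  \<comment> \<open>A preimage \<open>u\<close> would lie in the first zigzag, and the reversed walk
    from it would give a closed chain of length at most \<open>Suc j = n\<close>, below the least
    length \<open>e\<close>.\<close>
  have "X (x 0) \<notin> ?S"
  proof
    assume S: "X (x 0) \<in> ?S"
    show False
    proof (cases n)
      case 0
      then show ?thesis using S Xx0 by simp
    next
      case (Suc j)
      then obtain u where u: "u \<in> zigzag Y X j" "X (x 0) = Y u" using S by auto
      have "u \<in> ?D (Suc 0)" using u(2) x(2) by (auto intro!: image_eqI[of _ _ "x 0"])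
      moreover have "Y u \<noteq> 0" using u(2) Xx0 by simp
      ultimately obtain l where "l \<le> Suc 0 + j" "\<exists>y\<in>?D l. X y = 0 \<and> Y y \<noteq> 0"
        using zigzag_reverse[OF u(1)] by blast
      then show ?thesis using least[of l] n Suc by simp
    qed
  qed
  moreover have "subspace ?S"
    by (cases n) (simp_all add: endo.linear_subspace_image X subspace_zigzag Y)
  ultimately obtain p where p: "p \<in> perp ?S" "form p (X (x 0)) \<noteq> 0"
    using perp_separates by blast
  have "\<exists>q. q 0 = p \<and> (\<forall>i<n. adj X (q (Suc i)) = adj Y (q i))"
    by (rule cochain_exists[OF Y X]) (use p(1) in simp)
  then obtain q where q: "q 0 = p" "\<forall>i<n. adj X (q (Suc i)) = adj Y (q i)" by blast
  have "odd (dim UNIV)"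
    by (rule odd_of_closed_chain[where x = x and q = q and e = e, OF X Y indec XX YY XY YX x(2)])
      (use x y q p n in auto)
  then show ?thesis using even by blast
qed

text \<open>If both fail, \<open>X z = 0\<close>. The same lemma on the dual module forces
  \<open>range X \<subseteq> range Y\<close>, so \<open>z\<close> is a socle vector outside the
  radical and the dimension would be 1.\<close>

lemma exact_kronecker:
  assumes X: "lin X" and Y: "lin Y" and indec: "indec X Y" and even: "even (dim UNIV)"
    and XX: "\<And>x. X (X x) = 0" and YY: "\<And>x. Y (Y x) = 0"
    and XY: "\<And>x. X (Y x) = 0" and YX: "\<And>x. Y (X x) = 0"
  shows "(\<forall>m. X m = 0 \<longrightarrow> m \<in> range X) \<or> (\<forall>m. Y m = 0 \<longrightarrow> m \<in> range Y)"
proof (rule ccontr)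
  assume "\<not> ?thesis"
  then obtain m z where m: "X m = 0" "m \<notin> range X" and z: "Y z = 0" "z \<notin> range Y" by blast
  have sX: "subspace (range X)" and sY: "subspace (range Y)"
    using X Y by (auto intro: endo.linear_subspace_image)
  have Xz: "X z = 0"
    using exact_of_kernel_not_subset[OF X Y indec even XX YY XY YX z(1) _ m(1)] m(2) by blast
  have "range X \<subseteq> range Y"
  proof (rule ccontr)
    assume "\<not> range X \<subseteq> range Y"
    then obtain u where "X u \<notin> range Y" by blast
    then obtain w where w: "w \<in> perp (range Y)" "form w (X u) \<noteq> 0"
      using perp_separates[OF sY] by blast
    have wX: "adj X w \<noteq> 0"
    proof
      assume "adj X w = 0"
      then show False using w(2) form_adj[OF X, of w u] by simp
    qed
    \<comment> \<open>Here ker (adj X) = im (adj X), so every \<open>v\<close> orthogonal to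
      \<open>range X\<close> is orthogonal to \<open>m\<close>; this would put \<open>m\<close> into
      \<open>range X\<close>.\<close>
    have "form v m = 0" if v: "v \<in> perp (range X)" for v
    proof -
      have "v \<in> range (adj X)"
      proof (rule exact_of_kernel_not_subset[OF lin_adj lin_adj indec_adj[OF X Y indec] even])
        show "adj Y w = 0" "adj X w \<noteq> 0" "adj X v = 0"
          using w(1) wX v by (simp_all add: adj_eq_zero_iff X Y)
      qed (simp_all add: adj_comp_zero X Y XX YY XY YX)
      then obtain t where "v = adj X t" by blast
      then show ?thesis using m(1) by (simp add: form_adj X)
    qed
    then have "m \<in> perp (perp (range X))" by (simp add: perp_def form_commute)
    then show False using m(2) perp_perp[OF sX] by simp
  qed
  then have R: "{X a + Y b |a b. True} \<subseteq> range Y"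
    using subspace_add[OF sY] by blast
  have "dim UNIV = 1"
    by (rule socle_outside_radical[OF X Y indec Xz z(1)]) (use R z(2) in blast)
  then show False using even by simp
qed

theorem iso_dual_of_even_dim:
  assumes X: "lin X" and Y: "lin Y" and indec: "indec X Y" and even: "even (dim UNIV)"
    and XX: "\<And>x. X (X x) = 0" and YY: "\<And>x. Y (Y x) = 0" and comm: "\<And>x. Y (X x) = X (Y x)"
  shows "iso_dual X Y"
proof (cases "\<forall>x. X (Y x) = 0")
  case False
  then show ?thesis using iso_dual_product_nonzero[OF X Y indec XX YY comm] by blast
next
  case True
  then have XY: "X (Y x) = 0" and YX: "Y (X x) = 0" for x by (simp_all add: comm)
  from exact_kronecker[OF X Y indec even XX YY XY YX] show ?thesis
  proof
    assume "\<forall>m. X m = 0 \<longrightarrow> m \<in> range X"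
    then show ?thesis by (intro iso_dual_exact[OF X Y indec XX XY YX]) blast
  next
    assume "\<forall>m. Y m = 0 \<longrightarrow> m \<in> range Y"
    then show ?thesis
      by (intro iso_dual_commute[OF iso_dual_exact[OF Y X indec_commute[OF indec] YY YX XY]]) blast
  qed
qed

end

section \<open>Representations of the Klein four group\<close>

lemma klein_four_group_generators:
  fixes G (structure)
  assumes "klein_four_group G"
  obtains a b where "a \<in> carrier G" "b \<in> carrier G"
    "a \<otimes> a = \<one>" "b \<otimes> b = \<one>" "a \<otimes> b = b \<otimes> a"
    "carrier G = {\<one>, a, b, a \<otimes> b}"
proof -
  let ?V = "integer_mod_group 2 \<times>\<times> integer_mod_group 2"
  interpret group G using assms by (simp add: klein_four_group_def)
  have V: "group ?V" by (simp add: DirProd_group)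
  obtain h where h: "h \<in> iso ?V G"
    using assms iso_sym by (auto simp: klein_four_group_def is_iso_def)
  interpret h: group_hom ?V G h
    using h V by (simp add: group_hom_def group_hom_axioms_def is_group iso_iff)
  have "{0..<2::int} = {0, 1}" by auto
  then have carrier_V: "carrier ?V = {0, 1} \<times> {0, 1}"
    by (simp add: carrier_integer_mod_group)
  have mult: "h x \<otimes> h y = h (x \<otimes>\<^bsub>?V\<^esub> y)" if "x \<in> carrier ?V" "y \<in> carrier ?V" for x y
    using h.hom_mult[OF that] by simp
  have one: "h (0, 0) = \<one>" using h.hom_one by simp
  show ?thesis
  proof
    show "h (1, 0) \<in> carrier G" "h (0, 1) \<in> carrier G"
      by (auto intro!: h.hom_closed simp: carrier_V)
    show "h (1, 0) \<otimes> h (1, 0) = \<one>" "h (0, 1) \<otimes> h (0, 1) = \<one>"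
      "h (1, 0) \<otimes> h (0, 1) = h (0, 1) \<otimes> h (1, 0)"
      by (simp_all add: mult carrier_integer_mod_group one)
    have "carrier G = h ` carrier ?V" using h by (simp add: iso_iff)
    also have "\<dots> = {h (0, 0), h (1, 0), h (0, 1), h (1, 1)}" unfolding carrier_V by auto
    finally show "carrier G = {\<one>, h (1, 0), h (0, 1), h (1, 0) \<otimes> h (0, 1)}"
      by (simp add: mult carrier_integer_mod_group one)
  qed
qed

section \<open>From operators back to the group action\<close>

context group_representation
begin

lemma action_one: "\<rho> \<one> x = x"
  by (simp flip: id_eq_one)

lemma action_mult: "g \<in> carrier G \<Longrightarrow> h \<in> carrier G \<Longrightarrow> \<rho> (g \<otimes> h) x = \<rho> g (\<rho> h x)"
  by (simp add: composition_rule)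

lemma exists_coordinate_space: "\<exists>Basis. coordinate_space scale Basis"
proof -
  obtain B where B: "finite B" "span B = UNIV" using finite_dimensional by blast
  obtain C where C: "C \<subseteq> B" "independent C" "B \<subseteq> span C"
    by (rule maximal_independent_subset)
  have "span C = UNIV" using B(2) C(3) span_minimal[of B "span C"] by auto
  moreover have "finite C" using B(1) C(1) by (rule finite_subset[rotated])
  ultimately have "coordinate_space scale C"
    using C(2) by unfold_locales
  then show ?thesis by blast
qed

lemma self_dual_of_generators:
  assumes char: "CHAR('k) = 2" and indecomposable: indecomposable and even: "even (dim UNIV)"
    and a: "a \<in> carrier G" "a \<otimes> a = \<one>" and b: "b \<in> carrier G" "b \<otimes> b = \<one>"
    and ab: "a \<otimes> b = b \<otimes> a" and carrier: "carrier G = {\<one>, a, b, a \<otimes> b}"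
  shows self_dual
proof -
  obtain Basis where "coordinate_space scale Basis" using exists_coordinate_space by blast
  then interpret C: coordinate_space scale Basis .
  interpret G: group G using group_hom by (rule group_hom.axioms)
  define X where "X x = \<rho> a x - x" for x
  define Y where "Y x = \<rho> b x - x" for x
  have lin_a: "C.lin (\<rho> a)" and lin_b: "C.lin (\<rho> b)" using linear_action a b by auto
  have X: "C.lin X" and Y: "C.lin Y"
    using lin_a lin_b by (simp_all add: X_def Y_def C.lin_iff scale_right_diff_distrib)
  have two: "x + x = 0" for x :: 'v
  proof -
    have "(1 + 1 :: 'k) = of_nat CHAR('k)" unfolding char by simp
    then have "(1 + 1 :: 'k) = 0" by simp
    then show ?thesis by (metis scale_left_distrib scale_one scale_zero_left)
  qed
  have aa: "\<rho> a (\<rho> a x) = x" and bb: "\<rho> b (\<rho> b x) = x" and comm: "\<rho> b (\<rho> a x) = \<rho> a (\<rho> b x)" for x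
    using a b ab by (metis action_mult action_one)+
  \<comment> \<open>The square of \<open>\<rho> a - 1\<close> expands to this shape because
    \<open>a\<close> is an involution; it vanishes in characteristic 2.\<close>
  have diff_flip: "x - y - (y - x) = 0" for x y :: 'v
    using two[of "x - y"] by (simp add: algebra_simps)
  have XX: "X (X x) = 0" for x
    unfolding X_def by (simp add: C.endo.linear_diff[OF lin_a] aa diff_flip)
  have YY: "Y (Y x) = 0" for x
    unfolding Y_def by (simp add: C.endo.linear_diff[OF lin_b] bb diff_flip)
  have XY: "Y (X x) = X (Y x)" for x
    unfolding X_def Y_def by (simp add: C.endo.linear_diff[OF lin_a] C.endo.linear_diff[OF lin_b] comm)
  have sub: "subrepresentation U" if U: "C.invariant X Y U" for U
  proof -
    have sU: "subspace U" and XU: "X ` U \<subseteq> U" and YU: "Y ` U \<subseteq> U"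
      using U by (auto simp: C.invariant_def)
    have aU: "\<rho> a u \<in> U" and bU: "\<rho> b u \<in> U" if "u \<in> U" for u
    proof -
      have "X u + u \<in> U" "Y u + u \<in> U" using sU XU YU that by (auto intro!: subspace_add)
      then show "\<rho> a u \<in> U" "\<rho> b u \<in> U" by (simp_all add: X_def Y_def)
    qed
    show ?thesis
      unfolding subrepresentation_def carrier
      using sU aU bU by (auto simp: action_one action_mult a b)
  qed
  have "C.indec X Y"
    unfolding C.indec_def
  proof (intro conjI allI impI; (elim conjE)?)
    show "(UNIV :: 'v set) \<noteq> {0}" using indecomposable by (simp add: indecomposable_def)
    fix U W
    assume U: "C.invariant X Y U" and W: "C.invariant X Y W"
      and UW: "U \<inter> W \<subseteq> {0}" and d: "dim U + dim W = dim UNIV"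
    have sU: "subspace U" and sW: "subspace W" using U W by (auto simp: C.invariant_def)
    have "{x + y |x y. x \<in> U \<and> y \<in> W} = UNIV"
      using C.dim_direct_sum[OF sU sW UW] d sU sW by (intro C.subspace_eq_UNIV subspace_sums) auto
    moreover have "U \<inter> W = {0}" using UW subspace_0[OF sU] subspace_0[OF sW] by blast
    ultimately show "U = {0} \<or> W = {0}"
      using indecomposable sub[OF U] sub[OF W] unfolding indecomposable_def by blast
  qed
  then have "C.iso_dual X Y" using even XX YY XY by (intro C.iso_dual_of_even_dim X Y)
  then obtain \<phi> where \<phi>: "C.lin \<phi>" "bij \<phi>" and \<phi>X: "\<And>x. \<phi> (X x) = C.adj X (\<phi> x)"
    and \<phi>Y: "\<And>x. \<phi> (Y x) = C.adj Y (\<phi> x)"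
    unfolding C.iso_dual_def by blast
  \<comment> \<open>As \<open>\<rho> a\<close> is \<open>X\<close> plus the identity, its adjoint is
    \<open>adj X\<close> plus the identity. Since \<open>a\<close> is its own inverse, this is
    already the dual action.\<close>
  have \<phi>_a: "C.form (\<phi> (\<rho> a x)) y = C.form (\<phi> x) (\<rho> a y)" for x y
  proof -
    have "\<phi> (\<rho> a x) = \<phi> (X x) + \<phi> x"
      by (simp add: X_def C.endo.linear_add[OF \<phi>(1), symmetric])
    then show ?thesis by (simp add: \<phi>X C.form_add C.form_adj X) (simp add: X_def C.form_diff)
  qed
  have \<phi>_b: "C.form (\<phi> (\<rho> b x)) y = C.form (\<phi> x) (\<rho> b y)" for x y
  proof -
    have "\<phi> (\<rho> b x) = \<phi> (Y x) + \<phi> x"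
      by (simp add: Y_def C.endo.linear_add[OF \<phi>(1), symmetric])
    then show ?thesis by (simp add: \<phi>Y C.form_add C.form_adj Y) (simp add: Y_def C.form_diff)
  qed
  have inv: "inv a = a" "inv b = b" "inv (a \<otimes> b) = a \<otimes> b"
    using a b ab by (simp_all add: G.inv_equality G.inv_mult_group)
  have equivariant: "C.form (\<phi> (\<rho> g x)) y = C.form (\<phi> x) (\<rho> (inv g) y)" if "g \<in> carrier G" for g x y
    using that unfolding carrier
    by (auto simp: inv action_one action_mult a b \<phi>_a \<phi>_b comm)
  interpret K: vector_space "(*) :: 'k \<Rightarrow> 'k \<Rightarrow> 'k"
    by unfold_locales (auto simp: algebra_simps)
  show self_dual
    unfolding self_dual_def
  \<comment> \<open>The isomorphism is \<open>\<phi>\<close> followed by the identification of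
    vectors with functionals through the form.\<close>
  proof (intro exI[of _ "\<lambda>x. C.form (\<phi> x)"] conjI ballI allI)
    show "Vector_Spaces.linear scale dual_scale (\<lambda>x. C.form (\<phi> x))"
      unfolding Vector_Spaces.linear_iff
      using vector_space_axioms vector_space_dual_scale \<phi>(1)
      by (simp add: C.lin_iff C.form_simps dual_scale_def fun_eq_iff)
    have form_mem: "C.form d \<in> dual_space" for d
      unfolding dual_space_def Vector_Spaces.linear_iff
      using vector_space_axioms K.vector_space_axioms by (simp add: C.form_simps)
    have "inj (\<lambda>x. C.form (\<phi> x))"
    proof (rule injI)
      fix x y assume "C.form (\<phi> x) = C.form (\<phi> y)"
      then have "\<phi> x = \<phi> y" by (intro C.form_eqI) simp
      then show "x = y" using \<phi>(2) by (simp add: bij_def inj_eq)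
    qed
    moreover have "\<psi> \<in> range (\<lambda>x. C.form (\<phi> x))" if "\<psi> \<in> dual_space" for \<psi>
    proof -
      have "\<exists>d. \<psi> = C.form d"
        using that C.functional_eq_form[of \<psi>]
        unfolding dual_space_def Vector_Spaces.linear_iff by blast
      then obtain d where "\<psi> = C.form d" by blast
      moreover obtain x where "d = \<phi> x" using \<phi>(2) by (metis bij_pointE)
      ultimately show ?thesis by blast
    qed
    ultimately show "bij_betw (\<lambda>x. C.form (\<phi> x)) UNIV dual_space"
      using form_mem unfolding bij_betw_def by blast
    show "C.form (\<phi> (\<rho> g x)) = dual_action g (C.form (\<phi> x))" if "g \<in> carrier G" for g x
      using equivariant[OF that] by (simp add: dual_action_def fun_eq_iff)
  qed
qed

end

theorem proposition3p3:
  fixes G :: "('g, 'h) monoid_scheme"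
    and \<rho> :: "'g \<Rightarrow> 'v \<Rightarrow> 'v::ab_group_add"
    and scale :: "'k::field \<Rightarrow> 'v \<Rightarrow> 'v"
  assumes "CHAR('k) = 2"
    and "klein_four_group G"
    and "group_representation G \<rho> scale"
    and "group_representation.indecomposable G \<rho> scale"
    and "even (vector_space.dim scale (UNIV :: 'v set))"
  shows "group_representation.self_dual G \<rho> scale"
proof -
  interpret group_representation G \<rho> scale by fact
  obtain a b where "a \<in> carrier G" "b \<in> carrier G" "a \<otimes>\<^bsub>G\<^esub> a = \<one>\<^bsub>G\<^esub>" "b \<otimes>\<^bsub>G\<^esub> b = \<one>\<^bsub>G\<^esub>" "a \<otimes>\<^bsub>G\<^esub> b = b \<otimes>\<^bsub>G\<^esub> a"
    "carrier G = {\<one>\<^bsub>G\<^esub>, a, b, a \<otimes>\<^bsub>G\<^esub> b}"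
    using assms(2) by (rule klein_four_group_generators)
  with assms(1,4,5) show ?thesis by (intro self_dual_of_generators)
qed

end
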